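(* Let $\Omega\subset\mathbb{R}^d$ be a bounded convex polyhedral open set, $V\in C^2(\overline\Omega)$, $(\mathcal{T},\overline\Sigma,(x_K)_{K\in\mathcal{T}})$ an admissible mesh of $\Omega$, and $\tau>0$. For any $\boldsymbol\rho^n=(\rho^n_K)_{K\in\mathcal{T}}\in\mathbb{R}^{\mathcal{T}}$ with $\rho^n_K\ge0$ for all $K$ and $\sum_{K\in\mathcal{T}}m_K\rho^n_K>0$, there exist unique $\boldsymbol\theta^{n+1/2}\in\mathbb{R}^{\mathcal{T}}$ and $\boldsymbol\rho^{n+1}\in\mathbb{R}^{\mathcal{T}}$ such that, for all $K\in\mathcal{T}$, $$m_K\frac{\rho_K^{n+1}-\rho_K^n}{\tau}+\sum_{\sigma\in\Sigma_K}m_\sigma F_{K\sigma}^{n+1/2}=0,\qquad \rho_K^{n+1}=\Xi(\rho_K^n,\theta_K^{n+1/2}),$$ where, for $\sigma=K|L\in\Sigma_K$, $$F_{K\sigma}^{n+1/2}=\frac{\sqrt{\pi_K\pi_L}}{d_\sigma}\Big(\frac{\theta_K^{n+1/2}}{\pi_K}-\frac{\theta_L^{n+1/2}}{\pi_L}\Big).$$ Moreover, for all $K\in\mathcal{T}$, $$\theta_K^{n+1/2}>0,\qquad\rho_K^{n+1}\ge0,\qquad\sum_{K\in\mathcal{T}}m_K\rho_K^{n+1}=\sum_{K\in\mathcal{T}}m_K\rho_K^n,$$ and $$\frac{\rho_K^{n+1}+\rho_K^n}{2}\ \ge\ \theta_K^{n+1/2}\ \ge\ \min(\rho_K^{n+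1},\rho_K^n).$$
   Context: **Admissible mesh.** A triplet $(\mathcal{T},\overline\Sigma,(x_K)_{K\in\mathcal{T}})$ of cells, facets and cell centers $x_K\in\Omega$ such that: (1) the cells $K\in\mathcal{T}$ (finitely many) are disjoint open polyhedra of Lebesgue measure $m_K>0$, with $\bigcup_K\overline K=\overline\Omega$ and $\sum_Km_K=m_\Omega$ (the Lebesgue measure of $\Omega$); (2) facets $\sigma\in\overline\Sigma$ are closed subsets of $\overline\Omega$, each contained in a hyperplane, with $(d-1)$-dimensional measure $m_\sigma>0$; each facet is either an interior facet $\sigma=K|L:=\partial K\cap\partial L$ for some cells $K\ne L$, or a boundary facet $\sigma\subset\partial K\cap\partial\Omega$ for some cell $K$; distinct facets meet in sets of zero $(d-1)$-measure; $\Sigma\subset\overline\Sigma$ denotes the set of interior facets; (3) for every $K$ there is $\overline\Sigma_K\subset\overline\Sigma$ with $\partial K=\bigcup_{\sigma\in\overline\Sigma_K}\sigma$, $\overline\Sigma=\bigcup_K\overline\Sigma_K$, and $\Sigma_K=\overline\Sigma_K\cap\Sigma$; (4) $x_K=x_L$ iff $K=L$; for $\sigma=K|L$, $x_K-x_L$ is orthogonal to $\sigma$, $d_\sigma:=|x_K-x_L|$, and the unit outward normal to $K$ on $\sigma$ is $n_{K\sigma}=(x_L-x_K)/d_\sigma$. In sums over $\sigma\in\Sigma_K$, $L$ denotes the other cell with $\sigma=K|L$. **Discrete Gibbs weights.** $\pi_K=e^{-V(x_K)}$. **Extrapolation.** Let $f:[0,\infty)\to[e^{-1},\infty)$ be the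 continuous increasing bijection $f(r)=\exp\big(\frac{r\log r-r+1}{r-1}\big)$ for $r>0,r\ne1$, $f(1)=1$, $f(0)=e^{-1}$. Set $g(s)=f^{-1}(s)$ if $s>e^{-1}$, $g(s)=0$ otherwise; $\Xi(a,c)=a\,g(c/a)$ if $a>0$ and $\Xi(0,c)=e\,c$, for $c\in\mathbb{R}$. *)

theory Defs
  imports "HOL-Analysis.Analysis"
begin

section \<open>Polyhedral open sets and regularity up to the boundary\<close>

text \<open>Polyhedra are not assumed convex; the library's \<^const>\<open>polyhedron\<close> is a closed convex set.\<close>

definition polyhedral_open :: "'a::euclidean_space set \<Rightarrow> bool" where
  "polyhedral_open S \<longleftrightarrow> open S \<and>
     (\<exists>H. finite H \<and> (\<forall>h\<in>H. \<exists>a b. a \<noteq> 0 \<and> h = {y. a \<bullet> y = b}) \<and> frontier S \<subseteq> \<Union>H)"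

text \<open>\<open>V\<close> is of class $C^2$ on the closure of the open set \<open>S\<close>: it is $C^2$ in \<open>S\<close>, and
  \<open>V\<close> and its first two derivatives extend continuously to the closure.\<close>

definition C2_closure :: "'a::euclidean_space set \<Rightarrow> ('a \<Rightarrow> real) \<Rightarrow> bool" where
  "C2_closure S V \<longleftrightarrow>
     (\<exists>(V' :: 'a \<Rightarrow> 'a \<Rightarrow>\<^sub>L real) (V'' :: 'a \<Rightarrow> 'a \<Rightarrow>\<^sub>L ('a \<Rightarrow>\<^sub>L real)).
        (\<forall>y\<in>S. (V has_derivative blinfun_apply (V' y)) (at y)) \<and>
        (\<forall>y\<in>S. (V' has_derivative blinfun_apply (V'' y)) (at y)) \<and>
        continuous_on (closure S) V \<and>
        continuous_on (closure S) V' \<and>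
        continuous_on (closure S) V'')"


section \<open>The $(d-1)$-dimensional measure of a subset of a hyperplane\<close>

definition unit_normal :: "'a::euclidean_space set \<Rightarrow> 'a \<Rightarrow> bool" where
  "unit_normal \<sigma> u \<longleftrightarrow> norm u = 1 \<and> (\<exists>c. \<forall>y\<in>\<sigma>. u \<bullet> y = c)"

definition cylinder :: "'a::euclidean_space \<Rightarrow> 'a set \<Rightarrow> 'a set" where
  "cylinder u \<sigma> = {y + t *\<^sub>R u | y t. y \<in> \<sigma> \<and> 0 \<le> t \<and> t \<le> 1}"

text \<open>By Fubini, the $d$-dimensional measure of the orthogonal cylinder of height 1 over a
  (measurable) subset of a hyperplane is the $(d-1)$-dimensional measure of that subset. For
  \<open>d = 1\<close> this is the counting measure of a point. The choice of the normal is immaterial, see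
  \<open>facet_measure_eq\<close> below.\<close>

definition facet_measure :: "'a::euclidean_space set \<Rightarrow> real" where
  "facet_measure \<sigma> = measure lebesgue (cylinder (SOME u. unit_normal \<sigma> u) \<sigma>)"

lemma negligible_cylinder:
  assumes u: "unit_normal \<sigma> u" and v: "unit_normal \<sigma> v" and ne: "v \<noteq> u" "v \<noteq> - u"
  shows "negligible (cylinder u \<sigma>)"
proof -
  define w where "w = v - (v \<bullet> u) *\<^sub>R u"
  have n: "norm u = 1" "norm v = 1" and nu: "u \<bullet> u = 1"
    using u v by (auto simp: unit_normal_def norm_eq_1)
  have "w \<noteq> 0"
  proof
    assume "w = 0"
    then have e: "v = (v \<bullet> u) *\<^sub>R u" by (simp add: w_def)
    then have "norm v = \<bar>v \<bullet> u\<bar> * norm u" by (metis norm_scaleR)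
    then have "\<bar>v \<bullet> u\<bar> = 1" using n by simp
    then show False using e ne by (metis abs_1 abs_eq_iff scaleR_minus1_left scaleR_one)
  qed
  obtain c where c: "\<forall>y\<in>\<sigma>. u \<bullet> y = c" using u by (auto simp: unit_normal_def)
  obtain b where b: "\<forall>y\<in>\<sigma>. v \<bullet> y = b" using v by (auto simp: unit_normal_def)
  have "cylinder u \<sigma> \<subseteq> {y. w \<bullet> y = b - (v \<bullet> u) * c}"
    using c b nu by (auto simp: cylinder_def w_def inner_diff_left inner_add_right algebra_simps)
  then show ?thesis
    using negligible_hyperplane[of w] \<open>w \<noteq> 0\<close> negligible_subset by blast
qed

lemma facet_measure_eq:
  assumes u: "unit_normal \<sigma> u"
  shows "facet_measure \<sigma> = measure lebesgue (cylinder u \<sigma>)"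
proof -
  define v where "v = (SOME u. unit_normal \<sigma> u)"
  have v: "unit_normal \<sigma> v" unfolding v_def using u by (rule someI)
  have fm: "facet_measure \<sigma> = measure lebesgue (cylinder v \<sigma>)"
    by (simp add: facet_measure_def v_def)
  consider "v = u" | "v = - u" | "v \<noteq> u" "v \<noteq> - u" by blast
  then show ?thesis
  proof cases
    case 1
    then show ?thesis using fm by simp
  next
    case 2
    have "cylinder v \<sigma> = (+) (- u) ` cylinder u \<sigma>"
    proof (rule set_eqI, rule iffI)
      fix z assume "z \<in> cylinder v \<sigma>"
      then obtain y t where z: "z = y + t *\<^sub>R v" "y \<in> \<sigma>" "0 \<le> t" "t \<le> 1"
        by (auto simp: cylinder_def)
      then have "z = - u + (y + (1 - t) *\<^sub>R u)" using 2 by (simp add: algebra_simps)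
      moreover have "y + (1 - t) *\<^sub>R u \<in> cylinder u \<sigma>"
        unfolding cylinder_def using z by (intro CollectI exI[of _ y] exI[of _ "1 - t"]) auto
      ultimately show "z \<in> (+) (- u) ` cylinder u \<sigma>" by blast
    next
      fix z assume "z \<in> (+) (- u) ` cylinder u \<sigma>"
      then obtain y t where z: "z = - u + (y + t *\<^sub>R u)" "y \<in> \<sigma>" "0 \<le> t" "t \<le> 1"
        by (auto simp: cylinder_def)
      then have "z = y + (1 - t) *\<^sub>R v" using 2 by (simp add: algebra_simps)
      then show "z \<in> cylinder v \<sigma>"
        unfolding cylinder_def using z by (intro CollectI exI[of _ y] exI[of _ "1 - t"]) auto
    qed
    then show ?thesis using fm measure_translation[of "- u" "cylinder u \<sigma>"] by simp
  next
    case 3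
    have "negligible (cylinder u \<sigma>)" using negligible_cylinder[OF u v] 3 by blast
    moreover have "negligible (cylinder v \<sigma>)"
      using negligible_cylinder[OF v u] 3 by (metis add.inverse_inverse)
    ultimately show ?thesis using fm by (simp add: negligible_imp_measure0)
  qed
qed

text \<open>The expected value on an axis-parallel face of a box.\<close>

lemma facet_measure_box_face:
  fixes a b :: "'a::euclidean_space"
  assumes i: "i \<in> Basis" and ab: "\<And>j. j \<in> Basis \<Longrightarrow> a \<bullet> j \<le> b \<bullet> j"
  shows "facet_measure {y \<in> cbox a b. y \<bullet> i = a \<bullet> i} = (\<Prod>j\<in>Basis - {i}. b \<bullet> j - a \<bullet> j)"
proof -
  let ?F = "{y \<in> cbox a b. y \<bullet> i = a \<bullet> i}"
  define c where "c = b + (a \<bullet> i + 1 - b \<bullet> i) *\<^sub>R i"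
  have ci: "c \<bullet> i = a \<bullet> i + 1" using i by (simp add: c_def inner_add_left inner_Basis)
  have cj: "c \<bullet> j = b \<bullet> j" if "j \<in> Basis" "j \<noteq> i" for j
    using i that by (simp add: c_def inner_add_left inner_Basis)
  have "cylinder i ?F = cbox a c"
  proof (rule set_eqI, rule iffI)
    fix z assume "z \<in> cylinder i ?F"
    then obtain y t where z: "z = y + t *\<^sub>R i" "y \<in> ?F" "0 \<le> t" "t \<le> 1"
      by (auto simp: cylinder_def)
    have "a \<bullet> j \<le> z \<bullet> j \<and> z \<bullet> j \<le> c \<bullet> j" if "j \<in> Basis" for j
      using z ci cj[OF that] i that
      by (cases "j = i") (auto simp: inner_add_left inner_Basis mem_box)
    then show "z \<in> cbox a c" by (simp add: mem_box)
  next
    fix z assume z: "z \<in> cbox a c"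
    define y where "y = z - (z \<bullet> i - a \<bullet> i) *\<^sub>R i"
    have yi: "y \<bullet> i = a \<bullet> i" using i by (simp add: y_def inner_diff_left)
    have yj: "y \<bullet> j = z \<bullet> j" if "j \<in> Basis" "j \<noteq> i" for j
      using i that by (simp add: y_def inner_diff_left inner_Basis)
    have "a \<bullet> j \<le> y \<bullet> j \<and> y \<bullet> j \<le> b \<bullet> j" if "j \<in> Basis" for j
      using yi yj[OF that] cj[OF that] z ab[OF that] that
      by (cases "j = i") (auto simp: mem_box)
    then have "y \<in> ?F" using yi by (simp add: mem_box)
    moreover have "0 \<le> z \<bullet> i - a \<bullet> i" "z \<bullet> i - a \<bullet> i \<le> 1" using z i ci by (auto simp: mem_box)
    moreover have "z = y + (z \<bullet> i - a \<bullet> i) *\<^sub>R i" by (simp add: y_def)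
    ultimately show "z \<in> cylinder i ?F" unfolding cylinder_def by blast
  qed
  moreover have "unit_normal ?F i"
    using i by (auto simp: unit_normal_def inner_commute)
  moreover have "measure lebesgue (cbox a c) = (\<Prod>j\<in>Basis. c \<bullet> j - a \<bullet> j)"
  proof -
    have "a \<bullet> j \<le> c \<bullet> j" if "j \<in> Basis" for j
      using ab[OF that] ci cj[OF that] by (cases "j = i") auto
    then show ?thesis by (simp add: content_cbox inner_diff_left)
  qed
  moreover have "\<dots> = (c \<bullet> i - a \<bullet> i) * (\<Prod>j\<in>Basis - {i}. c \<bullet> j - a \<bullet> j)"
    using i by (subst prod.remove[of _ i]) auto
  moreover have "\<dots> = (\<Prod>j\<in>Basis - {i}. b \<bullet> j - a \<bullet> j)"
    using ci cj by simp
  ultimately show ?thesis using facet_measure_eq by metis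
qed


section \<open>Admissible meshes\<close>

text \<open>\<open>n\<close> is the unit outward normal to \<open>K\<close> on the facet \<open>\<sigma>\<close>. The pointwise condition can only be
  asked for almost everywhere on \<open>\<sigma>\<close>: at the corners of \<open>K\<close> the inward normal ray may leave \<open>K\<close>.\<close>

definition outward_unit_normal :: "'a::euclidean_space set \<Rightarrow> 'a set \<Rightarrow> 'a \<Rightarrow> bool" where
  "outward_unit_normal K \<sigma> n \<longleftrightarrow> unit_normal \<sigma> n \<and>
     negligible (cylinder n {y \<in> \<sigma>.
       \<not> (\<forall>\<^sub>F t in at_right 0. y - t *\<^sub>R n \<in> K \<and> y + t *\<^sub>R n \<notin> K)})"

definition interior_facets :: "'a::euclidean_space set set \<Rightarrow> 'a set set \<Rightarrow> 'a set set" where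
  "interior_facets T E =
     {\<sigma> \<in> E. \<exists>K\<in>T. \<exists>L\<in>T. K \<noteq> L \<and> \<sigma> = frontier K \<inter> frontier L}"

text \<open>\<open>T\<close> is the set of cells, \<open>E\<close> the set of all facets, \<open>EK K\<close> the set of all facets of the
  cell \<open>K\<close>, and \<open>x K\<close> the center of \<open>K\<close>.\<close>

locale admissible_mesh =
  fixes \<Omega> :: "'a::euclidean_space set"
    and T :: "'a set set"
    and E :: "'a set set"
    and EK :: "'a set \<Rightarrow> 'a set set"
    and x :: "'a set \<Rightarrow> 'a"
  assumes finite_cells: "finite T"
    and cells_polyhedral: "K \<in> T \<Longrightarrow> polyhedral_open K"
    and cells_measure_pos: "K \<in> T \<Longrightarrow> measure lebesgue K > 0"
    and cells_disjoint: "K \<in> T \<Longrightarrow> L \<in> T \<Longrightarrow> K \<noteq> L \<Longrightarrow> K \<inter> L = {}"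
    and cells_cover: "(\<Union>K\<in>T. closure K) = closure \<Omega>"
    and cells_sum_measure: "(\<Sum>K\<in>T. measure lebesgue K) = measure lebesgue \<Omega>"
    and facets_closed: "\<sigma> \<in> E \<Longrightarrow> closed \<sigma>"
    and facets_subset: "\<sigma> \<in> E \<Longrightarrow> \<sigma> \<subseteq> closure \<Omega>"
    and facets_hyperplane: "\<sigma> \<in> E \<Longrightarrow> \<exists>a b. a \<noteq> 0 \<and> \<sigma> \<subseteq> {y. a \<bullet> y = b}"
    and facets_measure_pos: "\<sigma> \<in> E \<Longrightarrow> facet_measure \<sigma> > 0"
    and facets_interior_or_boundary:
      "\<sigma> \<in> E \<Longrightarrow> \<sigma> \<in> interior_facets T E \<or> (\<exists>K\<in>T. \<sigma> \<subseteq> frontier K \<inter> frontier \<Omega>)"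
    and facets_inter_null:
      "\<sigma> \<in> E \<Longrightarrow> \<sigma>' \<in> E \<Longrightarrow> \<sigma> \<noteq> \<sigma>' \<Longrightarrow> facet_measure (\<sigma> \<inter> \<sigma>') = 0"
    and cell_facets_subset: "K \<in> T \<Longrightarrow> EK K \<subseteq> E"
    and cell_frontier: "K \<in> T \<Longrightarrow> frontier K = \<Union>(EK K)"
    and facets_eq: "E = (\<Union>K\<in>T. EK K)"
    and centers_mem: "K \<in> T \<Longrightarrow> x K \<in> \<Omega>"
    and centers_eq_iff: "K \<in> T \<Longrightarrow> L \<in> T \<Longrightarrow> x K = x L \<longleftrightarrow> K = L"
    and centers_orthogonal:
      "K \<in> T \<Longrightarrow> L \<in> T \<Longrightarrow> K \<noteq> L \<Longrightarrow> frontier K \<inter> frontier L \<in> E \<Longrightarrow>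
        y \<in> frontier K \<inter> frontier L \<Longrightarrow> z \<in> frontier K \<inter> frontier L \<Longrightarrow>
        (x K - x L) \<bullet> (y - z) = 0"
    and centers_outward:
      "K \<in> T \<Longrightarrow> L \<in> T \<Longrightarrow> K \<noteq> L \<Longrightarrow> frontier K \<inter> frontier L \<in> E \<Longrightarrow>
        outward_unit_normal K (frontier K \<inter> frontier L)
          ((x L - x K) /\<^sub>R norm (x K - x L))"

text \<open>The cell \<open>L\<close> such that \<open>\<sigma>\<close> is the interior facet between \<open>K\<close> and \<open>L\<close>.\<close>

definition other_cell :: "'a::euclidean_space set set \<Rightarrow> 'a set \<Rightarrow> 'a set \<Rightarrow> 'a set" where
  "other_cell T K \<sigma> = (THE L. L \<in> T \<and> L \<noteq> K \<and> \<sigma> = frontier K \<inter> frontier L)"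


section \<open>The extrapolation function\<close>

definition f_extrap :: "real \<Rightarrow> real" where
  "f_extrap r =
     (if r = 0 then exp (- 1)
      else if r = 1 then 1
      else exp ((r * ln r - r + 1) / (r - 1)))"

definition g_extrap :: "real \<Rightarrow> real" where
  "g_extrap s = (if s > exp (- 1) then the_inv_into {0..} f_extrap s else 0)"

text \<open>Only used for \<open>a \<ge> 0\<close>.\<close>

definition Xi :: "real \<Rightarrow> real \<Rightarrow> real" where
  "Xi a c = (if a > 0 then a * g_extrap (c / a) else exp 1 * c)"


section \<open>The scheme\<close>

definition gibbs :: "('a \<Rightarrow> real) \<Rightarrow> ('a set \<Rightarrow> 'a) \<Rightarrow> 'a set \<Rightarrow> real" where
  "gibbs V x K = exp (- V (x K))"

definition flux ::
  "('a::euclidean_space \<Rightarrow> real) \<Rightarrow> ('a set \<Rightarrow> 'a) \<Rightarrow> ('a set \<Rightarrow> real) \<Rightarrow> 'a set \<Rightarrow> 'a set \<Rightarrow> real" where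
  "flux V x \<theta> K L =
     sqrt (gibbs V x K * gibbs V x L) / norm (x K - x L) *
       (\<theta> K / gibbs V x K - \<theta> L / gibbs V x L)"

text \<open>One time step of length \<open>\<tau>\<close> from \<open>\<rho>\<close> to \<open>\<rho>'\<close>, with the intermediate unknown \<open>\<theta>\<close>.\<close>

definition scheme_step ::
  "'a::euclidean_space set set \<Rightarrow> 'a set set \<Rightarrow> ('a set \<Rightarrow> 'a set set) \<Rightarrow> ('a set \<Rightarrow> 'a) \<Rightarrow>
   ('a \<Rightarrow> real) \<Rightarrow> real \<Rightarrow> ('a set \<Rightarrow> real) \<Rightarrow> ('a set \<Rightarrow> real) \<Rightarrow> ('a set \<Rightarrow> real) \<Rightarrow> bool" where
  "scheme_step T E EK x V \<tau> \<rho> \<theta> \<rho>' \<longleftrightarrow>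
     (\<forall>K\<in>T.
        measure lebesgue K * ((\<rho>' K - \<rho> K) / \<tau>) +
          (\<Sum>\<sigma>\<in>EK K \<inter> interior_facets T E.
             facet_measure \<sigma> * flux V x \<theta> K (other_cell T K \<sigma>)) = 0 \<and>
        \<rho>' K = Xi (\<rho> K) (\<theta> K))"

end

theory Submission
  imports Defs "HOL-Real_Asymp.Real_Asymp"
begin

text \<open>In the unknowns \<open>u K = \<theta> K / \<pi> K\<close> the step is a discrete elliptic equation on the
  graph of cells: a graph Laplacian plus a nondecreasing zeroth-order term. Perron's method
  gives a solution; summing the equation over the set of cells where \<open>u \<le> 0\<close>, or where one solution
  exceeds another, gives positivity and uniqueness, provided the graph is connected. Connectedness and
  the fact that an interior facet belongs to exactly two cells come from the points
  near which all cell boundaries lie in one hyperplane: such a point lies in the closure of at most two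
  cells, almost every point of a facet is of this kind, and so is every point of a generic segment. The
  bounds on \<open>\<theta>\<close> say that \<open>f\<close> is the identric mean of its argument and 1, which lies between their
  minimum and their arithmetic mean.\<close>

section \<open>The extrapolation function\<close>

lemma ln_less_minus_one: "0 < x \<Longrightarrow> x \<noteq> 1 \<Longrightarrow> ln x < x - 1" for x :: real
  using ln_le_minus_one[of x] ln_eq_minus_one[of x] by linarith

text \<open>For positive \<open>r\<close>, \<open>h r\<close> is \<open>r - 1\<close> times the
  difference of the logarithms of the right and left sides. It vanishes at 1 and is nondecreasing,
  so it has the sign of \<open>r - 1\<close>; dividing by \<open>r - 1\<close> gives the bound on
  either side of 1.\<close>

lemma f_extrap_le_mean:
  assumes "0 \<le> r"
  shows "f_extrap r \<le> (1 + r) / 2"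
proof -
  define h where "h = (\<lambda>r::real. (r - 1) * ln ((1 + r) / 2) - (r * ln r - r + 1))"
  have "(h has_real_derivative ln ((1 + r) / 2) + (r - 1) / (1 + r) - ln r) (at r)"
    if "r > 0" for r
    unfolding h_def using that
    by (auto intro!: derivative_eq_intros simp: divide_simps) (simp add: algebra_simps)
  \<comment> \<open>This is \<open>ln y \<le> y - 1\<close> at
    \<open>y = 2 * r / (1 + r)\<close>.\<close>
  moreover have "0 \<le> ln ((1 + r) / 2) + (r - 1) / (1 + r) - ln r" if "r > 0" for r :: real
  proof -
    have "ln (2 * r / (1 + r)) \<le> 2 * r / (1 + r) - 1"
      using that by (intro ln_le_minus_one) auto
    moreover have "2 * r / (1 + r) - 1 = (r - 1) / (1 + r)"
      using that by (simp add: field_simps)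
    ultimately show ?thesis
      using that by (simp add: ln_div ln_mult)
  qed
  ultimately have mono: "h s \<le> h t" if "0 < s" "s \<le> t" for s t
    using that by (intro DERIV_nonneg_imp_nondecreasing[of s t h]) (meson less_le_trans)+
  have h1: "h 1 = 0" by (simp add: h_def)
  consider "r = 0" | "r = 1" | "0 < r" "r < 1" | "1 < r" using assms by linarith
  then show ?thesis
  proof cases
    case 1
    have "exp (1::real) \<ge> 2" using exp_ge_add_one_self[of 1] by simp
    then show ?thesis using 1 by (simp add: f_extrap_def exp_minus field_simps)
  next
    case 2
    then show ?thesis by (simp add: f_extrap_def)
  next
    case 3
    then have "h r \<le> 0" using mono[of r 1] h1 by simp
    then have "(r * ln r - r + 1) / (r - 1) \<le> ln ((1 + r) / 2)"
      using 3 by (simp add: h_def divide_le_eq mult.commute)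
    then show ?thesis using 3 by (simp add: f_extrap_def ln_ge_iff)
  next
    case 4
    then have "0 \<le> h r" using mono[of 1 r] h1 by simp
    then have "(r * ln r - r + 1) / (r - 1) \<le> ln ((1 + r) / 2)"
      using 4 by (simp add: h_def divide_le_eq mult.commute)
    then show ?thesis using 4 by (simp add: f_extrap_def ln_ge_iff)
  qed
qed

text \<open>In logarithms everything reduces to \<open>ln y \<le> y - 1\<close>: with
  \<open>y = r\<close> below 1, where the minimum is \<open>r\<close>, and with
  \<open>y = 1 / r\<close> above 1, where it is 1.\<close>

lemma min_le_f_extrap:
  assumes "0 \<le> r"
  shows "min r 1 \<le> f_extrap r"
proof -
  consider "r = 0" | "r = 1" | "0 < r" "r < 1" | "1 < r" using assms by linarith
  then show ?thesis
  proof cases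
    case 3
    then have "ln r \<le> (r * ln r - r + 1) / (r - 1)"
      using ln_le_minus_one[of r] by (simp add: le_divide_eq algebra_simps)
    then have "exp (ln r) \<le> f_extrap r" using 3 by (simp add: f_extrap_def del: exp_ln)
    then show ?thesis using 3 by simp
  next
    case 4
    have "ln (1 / r) \<le> 1 / r - 1" using 4 by (intro ln_le_minus_one) auto
    then have "0 \<le> (r * ln r - r + 1) / (r - 1)"
      using 4 by (simp add: ln_div field_simps)
    then show ?thesis using 4 by (simp add: f_extrap_def)
  qed (auto simp: f_extrap_def)
qed

text \<open>Off 0 and 1 the logarithm \<open>q\<close> has a positive derivative. Its formula is
  singular at 1, so the two branches are joined through the value 1, which \<open>f_extrap\<close>
  stays below on the left and above on the right.\<close>

lemma f_extrap_strict_mono: "strict_mono_on {0..} f_extrap"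
proof (rule strict_mono_onI)
  fix r s :: real assume "r \<in> {0..}" "s \<in> {0..}" and rs: "r < s"
  then have r0: "0 \<le> r" and s0: "0 < s" by auto
  define q where "q = (\<lambda>r::real. (r * ln r - r + 1) / (r - 1))"
  have q: "f_extrap t = exp (q t)" if "t > 0" "t \<noteq> 1" for t
    using that by (simp add: f_extrap_def q_def)
  have dq: "\<exists>y. (q has_real_derivative y) (at t) \<and> y > 0" if "t > 0" "t \<noteq> 1" for t
  proof (intro exI conjI)
    show "(q has_real_derivative (t - 1 - ln t) / (t - 1)\<^sup>2) (at t)"
      unfolding q_def using that
      by (auto intro!: derivative_eq_intros simp: field_simps power2_eq_square)
    show "(t - 1 - ln t) / (t - 1)\<^sup>2 > 0"
      using ln_less_minus_one[OF that] that by simp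
  qed
  have lt1: "f_extrap t < 1" if "0 \<le> t" "t < 1" for t
    using f_extrap_le_mean[OF that(1)] that by simp
  have gt1: "f_extrap t > 1" if "1 < t" for t
  proof -
    have "ln (1 / t) < 1 / t - 1" using that by (intro ln_less_minus_one) auto
    then have "0 < q t" using that by (simp add: q_def ln_div field_simps)
    then show ?thesis using q[of t] that by simp
  qed
  consider "r = 0" "s < 1" | "0 < r" "s < 1" | "r < 1" "s = 1" | "r < 1" "s > 1"
    | "r = 1" | "r > 1" using r0 rs by linarith
  then show "f_extrap r < f_extrap s"
  proof cases
    case 1
    \<comment> \<open>Multiplied by the negative number \<open>s - 1\<close>, the inequality
      \<open>- 1 < q s\<close> becomes \<open>s * ln s < 0\<close>.\<close>
    have "s * ln s < 0" using s0 1 by (simp add: mult_pos_neg)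
    then have "- 1 < q s" using 1 by (simp add: q_def less_divide_eq)
    then show ?thesis using q[of s] s0 1 by (simp add: f_extrap_def)
  next
    case 2
    have "q r < q s" using 2 rs by (intro DERIV_pos_imp_increasing[OF rs] dq) auto
    then show ?thesis using q 2 rs s0 by simp
  next
    case 3
    then show ?thesis using lt1[of r] r0 by (simp add: f_extrap_def)
  next
    case 4
    then show ?thesis using lt1[of r] gt1[of s] r0 by simp
  next
    case 5
    then show ?thesis using gt1[of s] rs by (simp add: f_extrap_def)
  next
    case 6
    have "q r < q s" using 6 rs by (intro DERIV_pos_imp_increasing[OF rs] dq) auto
    then show ?thesis using q 6 rs s0 by simp
  qed
qed

text \<open>At 1 the two bounds \<open>min r 1\<close> and \<open>(1 + r) / 2\<close> squeeze the
  function, so the quotient 0/0 need not be expanded; at 0 a one-sided limit suffices, since the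
  domain ends there.\<close>

lemma continuous_on_f_extrap: "continuous_on {0..} f_extrap"
proof -
  have "continuous (at t within {0..}) f_extrap" if t: "t \<ge> 0" for t
  proof -
    consider "t = 0" | "t = 1" | "0 < t" "t \<noteq> 1" using t by linarith
    then show ?thesis
    proof cases
      case 1
      have "((\<lambda>r::real. exp ((r * ln r - r + 1) / (r - 1))) \<longlongrightarrow> exp (- 1)) (at_right 0)"
        by real_asymp
      moreover have "\<forall>\<^sub>F r in at_right 0. exp ((r * ln r - r + 1) / (r - 1)) = f_extrap r"
        unfolding eventually_at_right_field
        by (intro exI[of _ 1]) (auto simp: f_extrap_def)
      ultimately have "(f_extrap \<longlongrightarrow> exp (- 1)) (at_right 0)"
        by (simp add: tendsto_cong)
      moreover have "f_extrap 0 = exp (- 1)" by (simp add: f_extrap_def)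
      ultimately show ?thesis
        using 1 by (simp add: continuous_within at_within_Ici_at_right)
    next
      case 2
      have ev: "\<forall>\<^sub>F r in at (1::real). 0 < r"
        by (intro order_tendstoD(1)[of _ 1] tendsto_ident_at) simp
      have "(f_extrap \<longlongrightarrow> 1) (at 1)"
      proof (rule tendsto_sandwich)
        show "\<forall>\<^sub>F r in at 1. min r 1 \<le> f_extrap r"
          using ev by eventually_elim (rule min_le_f_extrap, simp)
        show "\<forall>\<^sub>F r in at 1. f_extrap r \<le> (1 + r) / 2"
          using ev by eventually_elim (rule f_extrap_le_mean, simp)
        show "((\<lambda>r::real. min r 1) \<longlongrightarrow> 1) (at 1)"
          by (rule tendsto_eq_intros | simp)+
        show "((\<lambda>r::real. (1 + r) / 2) \<longlongrightarrow> 1) (at 1)"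
          by (rule tendsto_eq_intros | simp)+
      qed
      then show ?thesis
        using 2 by (auto simp: continuous_within f_extrap_def intro: tendsto_within_subset)
    next
      case 3
      have "isCont (\<lambda>r. exp ((r * ln r - r + 1) / (r - 1))) t"
        using 3 by (intro continuous_intros) auto
      moreover have "\<forall>\<^sub>F r in nhds t. f_extrap r = exp ((r * ln r - r + 1) / (r - 1))"
      proof -
        have "\<forall>\<^sub>F r in nhds t. r \<in> {0<..} - {1}"
          using 3 by (intro eventually_nhds_in_open) auto
        then show ?thesis by eventually_elim (auto simp: f_extrap_def)
      qed
      ultimately have "isCont f_extrap t" by (simp add: isCont_cong)
      then show ?thesis by (rule continuous_at_imp_continuous_at_within)
    qed
  qed
  then show ?thesis by (simp add: continuous_on_eq_continuous_within)
qed

lemma f_extrap_surj: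
  assumes "s \<ge> exp (- 1)"
  obtains r where "r \<ge> 0" "f_extrap r = s"
proof -
  \<comment> \<open>For \<open>b > 1\<close> the exponent is at least \<open>ln b - 1\<close>, so
    \<open>f_extrap b\<close> is at least \<open>b / exp 1\<close>; hence
    \<open>b \<ge> exp 1 * s\<close> reaches \<open>s\<close>. The 2 only ensures
    \<open>b > 1\<close>.\<close>
  define b where "b = max (exp 1 * s) 2"
  have b: "b > 1" "exp 1 * s \<le> b" by (auto simp: b_def)
  have "ln b - 1 \<le> (b * ln b - b + 1) / (b - 1)"
    using b by (simp add: le_divide_eq algebra_simps)
  then have "exp (ln b - 1) \<le> f_extrap b" using b by (simp add: f_extrap_def)
  moreover have "s \<le> exp (ln b - 1)" using b by (simp add: exp_diff field_simps)
  ultimately have "s \<le> f_extrap b" by simp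
  moreover have "f_extrap 0 \<le> s" using assms by (simp add: f_extrap_def)
  moreover have "continuous_on {0..b} f_extrap"
    by (rule continuous_on_subset[OF continuous_on_f_extrap]) auto
  ultimately obtain r where "0 \<le> r" "f_extrap r = s"
    using IVT'[of f_extrap 0 s b] b by auto
  then show ?thesis using that by blast
qed

section \<open>The inverse function \<open>g_extrap\<close>\<close>

lemma bij_betw_f_extrap: "bij_betw f_extrap {0..} {exp (- 1)..}"
proof -
  have "exp (- 1) \<le> f_extrap r" if "0 \<le> r" for r
    using strict_mono_onD[OF f_extrap_strict_mono, of 0 r] that
    by (cases "r = 0") (auto simp: f_extrap_def)
  moreover have "s \<in> f_extrap ` {0..}" if "exp (- 1) \<le> s" for s
    using f_extrap_surj[OF that] by (metis atLeast_iff imageI)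
  ultimately have "f_extrap ` {0..} = {exp (- 1)..}"
    by auto
  then show ?thesis
    using f_extrap_strict_mono by (simp add: bij_betw_def strict_mono_on_imp_inj_on)
qed

lemma g_extrap_nonneg: "0 \<le> g_extrap s"
  and f_g_extrap: "exp (- 1) \<le> s \<Longrightarrow> f_extrap (g_extrap s) = s"
proof -
  note inv = bij_betw_the_inv_into[OF bij_betw_f_extrap]
  show "0 \<le> g_extrap s"
    using bij_betwE[OF inv] by (auto simp: g_extrap_def)
  \<comment> \<open>At the end point \<open>s = exp (- 1)\<close> the default value 0 of
    \<open>g_extrap\<close> is the true preimage.\<close>
  show "f_extrap (g_extrap s) = s" if "exp (- 1) \<le> s"
    using that f_the_inv_into_f_bij_betw[OF bij_betw_f_extrap, of s]
    by (auto simp: g_extrap_def f_extrap_def)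
qed

text \<open>Only the larger argument must exceed \<open>exp (- 1)\<close>: if the smaller one lies
  below, its value is the default 0, whereas \<open>g_extrap t\<close> is nonzero because
  \<open>f_extrap 0 = exp (- 1)\<close>.\<close>

lemma g_extrap_less:
  assumes "s < t" "exp (- 1) < t"
  shows "g_extrap s < g_extrap t"
proof -
  have t: "f_extrap (g_extrap t) = t" using assms by (simp add: f_g_extrap)
  show ?thesis
  proof (cases "exp (- 1) \<le> s")
    case True
    show ?thesis
    proof (rule ccontr)
      assume "\<not> g_extrap s < g_extrap t"
      then have "f_extrap (g_extrap t) \<le> f_extrap (g_extrap s)"
        using strict_mono_on_leD[OF f_extrap_strict_mono] g_extrap_nonneg by simp
      then show False using assms t f_g_extrap[OF True] by simp
    qed
  next
    case False
    then have "g_extrap s = 0" by (simp add: g_extrap_def)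
    moreover have "g_extrap t \<noteq> 0" using t assms by (auto simp: f_extrap_def)
    ultimately show ?thesis using g_extrap_nonneg[of t] by simp
  qed
qed

lemma g_extrap_mono: "s \<le> t \<Longrightarrow> g_extrap s \<le> g_extrap t"
  using g_extrap_less[of s t] g_extrap_nonneg[of t]
  by (cases "exp (- 1) < t"; cases "s = t") (auto simp: g_extrap_def)

lemma g_f_extrap:
  assumes "0 \<le> r"
  shows "g_extrap (f_extrap r) = r"
proof (rule inj_onD[OF strict_mono_on_imp_inj_on[OF f_extrap_strict_mono]])
  show "f_extrap (g_extrap (f_extrap r)) = f_extrap r"
    using bij_betwE[OF bij_betw_f_extrap] assms by (intro f_g_extrap) auto
qed (use assms g_extrap_nonneg in auto)

text \<open>Continuing \<open>g_extrap\<close> with slope 1 to the left of \<open>exp (- 1)\<close> makes it a monotone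
  surjection of the line, hence continuous.\<close>

lemma continuous_on_g_extrap: "continuous_on UNIV g_extrap"
proof -
  define k where "k = (\<lambda>s. if exp (- 1) < s then g_extrap s else s - exp (- 1))"
  have "k s \<le> k t" if "s \<le> t" for s t
    using that g_extrap_mono[of s t] g_extrap_nonneg[of t] by (auto simp: k_def)
  moreover have "r \<in> range k" for r
  proof (cases "r > 0")
    case True
    then have "f_extrap r > exp (- 1)"
      using strict_mono_onD[OF f_extrap_strict_mono, of 0 r] by (simp add: f_extrap_def)
    then have "k (f_extrap r) = r" using True g_f_extrap[of r] by (simp add: k_def)
    then show ?thesis by (metis rangeI)
  next
    case False
    then have "k (r + exp (- 1)) = r" by (simp add: k_def)
    then show ?thesis by (metis rangeI)
  qed
  then have "range k = UNIV" by auto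
  ultimately have "continuous_on UNIV k" by (intro continuous_onI_mono) auto
  then have "continuous_on UNIV (\<lambda>s. max 0 (k s))" by (intro continuous_intros)
  moreover have "max 0 (k s) = g_extrap s" for s
    using g_extrap_nonneg[of s] by (auto simp: k_def g_extrap_def)
  ultimately show ?thesis by simp
qed

section \<open>Monotonicity and bounds of \<open>Xi\<close>\<close>

lemma continuous_on_Xi: "continuous_on A (Xi a)"
proof (cases "a > 0")
  case True
  have "continuous_on A (\<lambda>c. a * g_extrap (c / a))"
    by (intro continuous_intros continuous_on_compose2[OF continuous_on_g_extrap]) (use True in auto)
  then show ?thesis using True by (simp add: Xi_def[abs_def])
next
  case False
  then show ?thesis by (simp add: Xi_def[abs_def] continuous_intros)
qed

lemma Xi_mono: "c \<le> d \<Longrightarrow> Xi a c \<le> Xi a d"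
  by (auto simp: Xi_def intro!: mult_left_mono g_extrap_mono divide_right_mono)

text \<open>A flat piece of \<open>Xi a\<close> can only come from the zero branch of
  \<open>g_extrap\<close>; for \<open>a \<le> 0\<close> the map is linear with slope
  \<open>exp 1\<close> and has none.\<close>

lemma Xi_eq_imp_0:
  assumes "c < d" "Xi a c = Xi a d"
  shows "Xi a d = 0"
proof (cases "a > 0")
  case True
  then have "c / a < d / a" using assms by (simp add: divide_strict_right_mono)
  then show ?thesis
    using True assms g_extrap_less[of "c / a" "d / a"] by (auto simp: Xi_def g_extrap_def)
next
  case False
  then show ?thesis using assms by (simp add: Xi_def)
qed

lemma Xi_nonneg: "0 \<le> c \<Longrightarrow> 0 \<le> Xi a c"
  by (auto simp: Xi_def g_extrap_nonneg)

text \<open>For \<open>a > 0\<close> the argument \<open>c / a\<close> lies below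
  \<open>exp (- 1)\<close>, so the value is 0; for \<open>a = 0\<close> it is
  \<open>exp 1 * c\<close>. The equality case will show that a density unchanged under a nonpositive
  \<open>\<theta>\<close> vanishes.\<close>

lemma Xi_nonpos:
  assumes "0 \<le> a" "c \<le> 0"
  shows "Xi a c \<le> 0" and "Xi a c = a \<Longrightarrow> a = 0 \<and> c = 0"
proof -
  have "\<not> exp (- 1) < c / a" if "a > 0"
    using that assms divide_nonpos_pos[of c a] by (simp add: not_less) (meson exp_ge_zero order_trans)
  then show "Xi a c \<le> 0" "Xi a c = a \<Longrightarrow> a = 0 \<and> c = 0"
    using assms by (auto simp: Xi_def g_extrap_def mult_nonneg_nonpos split: if_splits)
qed

text \<open>For \<open>a > 0\<close>, \<open>g_extrap 1 = 1\<close> makes \<open>a\<close> a fixed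
  point of \<open>Xi a\<close>, and \<open>Xi a\<close> is strictly increasing beyond it. This
  provides the upper barrier for existence.\<close>

lemma Xi_greater:
  assumes "0 \<le> a" "a < c"
  shows "a < Xi a c"
proof (cases "a > 0")
  case True
  have "g_extrap 1 = 1" using g_f_extrap[of 1] by (simp add: f_extrap_def)
  then have "1 < g_extrap (c / a)"
    using g_extrap_less[of 1 "c / a"] True assms by (simp add: less_trans[of "exp (-1)" 1])
  then show ?thesis using True by (simp add: Xi_def)
next
  case False
  then show ?thesis using assms by (simp add: Xi_def)
qed

text \<open>Above the threshold, \<open>c = a * f_extrap r\<close> and the claims are the two bounds
  on \<open>f_extrap\<close> scaled by \<open>a\<close>. Below it \<open>Xi a c = 0\<close> and
  \<open>c \<le> a / exp 1\<close>; this case and \<open>a = 0\<close> both rest on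
  \<open>exp 1 \<ge> 2\<close>.\<close>

lemma Xi_between:
  assumes "0 \<le> a" "0 < c"
  shows "c \<le> (Xi a c + a) / 2" and "min (Xi a c) a \<le> c"
proof -
  have e: "exp (1::real) \<ge> 2" using exp_ge_add_one_self[of 1] by simp
  have "c \<le> (Xi a c + a) / 2 \<and> min (Xi a c) a \<le> c"
  proof (cases "a > 0")
    case True
    define r where "r = g_extrap (c / a)"
    have r: "0 \<le> r" "Xi a c = a * r" using True by (auto simp: r_def g_extrap_nonneg Xi_def)
    show ?thesis
    proof (cases "exp (- 1) < c / a")
      case gt: True
      then have c: "c = a * f_extrap r" using True by (simp add: r_def f_g_extrap)
      have "a * f_extrap r \<le> a * ((1 + r) / 2)"
        using f_extrap_le_mean[OF r(1)] True by (intro mult_left_mono) auto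
      moreover have "a * min r 1 \<le> a * f_extrap r"
        using min_le_f_extrap[OF r(1)] True by (intro mult_left_mono) auto
      moreover have "a * min r 1 = min (a * r) a"
        using True by (simp add: min_mult_distrib_left)
      ultimately show ?thesis using c r by (simp add: algebra_simps)
    next
      case le: False
      then have "c \<le> a * exp (- 1)" using True by (simp add: field_simps)
      moreover have "a * exp (- 1) \<le> a / 2"
        using True e by (simp add: exp_minus field_simps)
      moreover have "r = 0" using le by (simp add: r_def g_extrap_def)
      ultimately show ?thesis using r assms by simp
    qed
  next
    case False
    then show ?thesis using assms e by (simp add: Xi_def)
  qed
  then show "c \<le> (Xi a c + a) / 2" "min (Xi a c) a \<le> c" by auto
qed

section \<open>Monotone nonlinear equations on a finite graph\<close>

text \<open>Perron's method: the pointwise supremum of all subsolutions is a solution, since raising its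
  value at a cell where the inequality is strict would give a larger subsolution.\<close>

lemma graph_equation_solvable:
  fixes \<phi> :: "'k \<Rightarrow> real \<Rightarrow> real" and w :: "'k \<Rightarrow> 'k \<Rightarrow> real"
  assumes fin: "finite T"
    and w: "\<And>K L. K \<in> T \<Longrightarrow> L \<in> T \<Longrightarrow> 0 \<le> w K L"
    and cont: "\<And>K. K \<in> T \<Longrightarrow> continuous_on UNIV (\<phi> K)"
    and low: "\<And>K. K \<in> T \<Longrightarrow> \<phi> K 0 \<le> 0"
    and high: "\<And>K t. K \<in> T \<Longrightarrow> M < t \<Longrightarrow> 0 < \<phi> K t"
  shows "\<exists>u. \<forall>K\<in>T. \<phi> K (u K) + (\<Sum>L\<in>T. w K L * (u K - u L)) = 0"
proof -
  define G where "G = (\<lambda>u K. \<phi> K (u K) + (\<Sum>L\<in>T. w K L * (u K - u L)))"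
  define S where "S = {u. \<forall>K\<in>T. G u K \<le> 0}"
  \<comment> \<open>Discrete maximum principle: at a cell where \<open>u\<close> is maximal the
    graph term is nonnegative, so \<open>\<phi>\<close> is nonpositive there and the maximum cannot
    exceed \<open>M\<close>.\<close>
  have le_M: "u K \<le> M" if u: "u \<in> S" and K: "K \<in> T" for u K
  proof -
    have "Max (u ` T) \<in> u ` T" using fin K by (intro Max_in) auto
    then obtain K0 where "K0 \<in> T" "Max (u ` T) = u K0" by auto
    then have K0: "K0 \<in> T" "\<And>L. L \<in> T \<Longrightarrow> u L \<le> u K0"
      using Max_ge[of "u ` T"] fin by auto
    have "0 \<le> (\<Sum>L\<in>T. w K0 L * (u K0 - u L))"
      using K0 w by (intro sum_nonneg mult_nonneg_nonneg) auto
    moreover have "G u K0 \<le> 0" using u K0 by (simp add: S_def)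
    ultimately have "u K0 \<le> M" using high[OF K0(1), of "u K0"] by (force simp: G_def)
    then show ?thesis using K0(2)[OF K] by simp
  qed
  have "(\<lambda>K. 0) \<in> S" using low by (simp add: S_def G_def)
  then have ne: "S \<noteq> {}" by auto
  have bdd: "bdd_above ((\<lambda>u. u K) ` S)" if "K \<in> T" for K
    using le_M that by (intro bdd_aboveI[of _ M]) auto
  define v where "v = (\<lambda>K. SUP u\<in>S. u K)"
  have le_v: "u K \<le> v K" if "u \<in> S" "K \<in> T" for u K
    unfolding v_def using that by (intro cSUP_upper bdd)
  \<comment> \<open>The supremum at different cells may come from different subsolutions. With the
    neighbour values frozen at \<open>v\<close>, the admissible values at \<open>K\<close> form a
    closed set containing \<open>u K\<close> for every subsolution \<open>u\<close>, hence also
    \<open>v K\<close>.\<close>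
  have sub: "G v K \<le> 0" if K: "K \<in> T" for K
  proof -
    define C where "C = {t. \<phi> K t + (\<Sum>L\<in>T. w K L * (t - v L)) \<le> 0}"
    have "closed C" unfolding C_def
      by (intro closed_Collect_le continuous_intros cont K)
    moreover have "(\<lambda>u. u K) ` S \<subseteq> C"
    proof clarify
      fix u assume u: "u \<in> S"
      have "(\<Sum>L\<in>T. w K L * (u K - v L)) \<le> (\<Sum>L\<in>T. w K L * (u K - u L))"
        using le_v[OF u] w K by (intro sum_mono mult_left_mono) auto
      moreover have "G u K \<le> 0" using u K by (simp add: S_def)
      ultimately show "u K \<in> C" by (simp add: C_def G_def)
    qed
    ultimately have "closure ((\<lambda>u. u K) ` S) \<subseteq> C" by (rule closure_minimal[rotated])
    moreover have "v K \<in> closure ((\<lambda>u. u K) ` S)"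
      unfolding v_def using ne bdd[OF K] by (intro closure_contains_Sup) auto
    ultimately show ?thesis by (auto simp: C_def G_def)
  qed
  have "G v K = 0" if K: "K \<in> T" for K
  proof (rule ccontr)
    assume "G v K \<noteq> 0"
    then have neg: "G v K < 0" using sub[OF K] by simp
    \<comment> \<open>The update also enters the diagonal term \<open>L = K\<close>, which stays 0
      whatever \<open>w K K\<close> is.\<close>
    have upd: "continuous_on UNIV (\<lambda>t. w K L * (t - (v(K := t)) L))" for L
      by (cases "L = K") (auto intro!: continuous_intros)
    have "open {t. \<phi> K t + (\<Sum>L\<in>T. w K L * (t - (v(K := t)) L)) < 0}"
      by (intro open_Collect_less continuous_on_add continuous_on_sum continuous_on_const upd cont K)
    moreover have "v K \<in> {t. \<phi> K t + (\<Sum>L\<in>T. w K L * (t - (v(K := t)) L)) < 0}"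
      using neg by (simp add: G_def del: fun_upd_apply)
    ultimately obtain e where e: "e > 0"
      and ball: "ball (v K) e \<subseteq> {t. \<phi> K t + (\<Sum>L\<in>T. w K L * (t - (v(K := t)) L)) < 0}"
      by (meson openE)
    define t where "t = v K + e / 2"
    have "t \<in> ball (v K) e" using e by (simp add: t_def dist_real_def)
    then have "G (v(K := t)) K < 0" using ball by (auto simp: G_def)
    \<comment> \<open>Raising the value at \<open>K\<close> only lowers the differences seen from
      the other cells.\<close>
    moreover have "G (v(K := t)) L \<le> 0" if L: "L \<in> T" "L \<noteq> K" for L
    proof -
      have "(\<Sum>J\<in>T. w L J * ((v(K := t)) L - (v(K := t)) J)) \<le> (\<Sum>J\<in>T. w L J * (v L - v J))"
        using L w e by (intro sum_mono mult_left_mono) (auto simp: t_def)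
      then have "G (v(K := t)) L \<le> G v L" using L by (simp add: G_def)
      then show ?thesis using sub L by force
    qed
    ultimately have "v(K := t) \<in> S" by (force simp: S_def)
    from le_v[OF this K] show False using e by (simp add: t_def)
  qed
  then show ?thesis by (auto simp: G_def)
qed

text \<open>Exchange terms between two cells of \<open>D\<close> are antisymmetric and cancel in
  pairs, so only those leaving \<open>D\<close> remain.\<close>

lemma sum_graph_laplacian_cut:
  fixes w :: "'k \<Rightarrow> 'k \<Rightarrow> real"
  assumes "finite T" "D \<subseteq> T" and sym: "\<And>K L. K \<in> T \<Longrightarrow> L \<in> T \<Longrightarrow> w K L = w L K"
  shows "(\<Sum>K\<in>D. \<Sum>L\<in>T. w K L * (u K - u L)) = (\<Sum>K\<in>D. \<Sum>L\<in>T - D. w K L * (u K - u L))"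
proof -
  have "(\<Sum>K\<in>D. \<Sum>L\<in>D. w K L * (u K - u L)) = (\<Sum>K\<in>D. \<Sum>L\<in>D. w L K * (u L - u K))"
    by (rule sum.swap)
  also have "\<dots> = - (\<Sum>K\<in>D. \<Sum>L\<in>D. w K L * (u K - u L))"
    unfolding sum_negf[symmetric]
  proof (intro sum.cong refl)
    fix K L assume "K \<in> D" "L \<in> D"
    then have "w L K = w K L" using assms by auto
    then show "w L K * (u L - u K) = - (w K L * (u K - u L))" by (simp add: algebra_simps)
  qed
  finally have "(\<Sum>K\<in>D. \<Sum>L\<in>D. w K L * (u K - u L)) = 0" by simp
  moreover have "(\<Sum>L\<in>T. w K L * (u K - u L))
      = (\<Sum>L\<in>T - D. w K L * (u K - u L)) + (\<Sum>L\<in>D. w K L * (u K - u L))" for K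
    using assms by (intro sum.subset_diff)
  ultimately show ?thesis by (simp add: sum.distrib)
qed

text \<open>One step of the scheme on an abstract connected weighted graph, in the unknown
  \<open>u K = \<theta> K / p K\<close>.\<close>

locale graph_scheme =
  fixes T :: "'k set" and w :: "'k \<Rightarrow> 'k \<Rightarrow> real" and m p \<rho> :: "'k \<Rightarrow> real" and \<tau> :: real
  assumes finite_T: "finite T"
    and w_sym: "K \<in> T \<Longrightarrow> L \<in> T \<Longrightarrow> w K L = w L K"
    and w_nonneg: "K \<in> T \<Longrightarrow> L \<in> T \<Longrightarrow> 0 \<le> w K L"
    and connected_graph: "D \<subseteq> T \<Longrightarrow> D \<noteq> {} \<Longrightarrow> D \<noteq> T \<Longrightarrow> \<exists>K\<in>D. \<exists>L\<in>T - D. 0 < w K L"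
    and m_pos: "K \<in> T \<Longrightarrow> 0 < m K"
    and p_pos: "K \<in> T \<Longrightarrow> 0 < p K"
    and tau_pos: "0 < \<tau>"
    and rho_nonneg: "K \<in> T \<Longrightarrow> 0 \<le> \<rho> K"
    and mass_pos: "0 < (\<Sum>K\<in>T. m K * \<rho> K)"
begin

section \<open>Existence, mass conservation, positivity and comparison of solutions on the
  graph\<close>

definition accumulation :: "'k \<Rightarrow> real \<Rightarrow> real" where
  "accumulation K t = m K * ((Xi (\<rho> K) (p K * t) - \<rho> K) / \<tau>)"

definition solution :: "('k \<Rightarrow> real) \<Rightarrow> bool" where
  "solution u \<longleftrightarrow> (\<forall>K\<in>T. accumulation K (u K) + (\<Sum>L\<in>T. w K L * (u K - u L)) = 0)"

lemma solution_exists: "\<exists>u. solution u"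
  unfolding solution_def
proof (rule graph_equation_solvable)
  show "continuous_on UNIV (accumulation K)" if "K \<in> T" for K
    unfolding accumulation_def
    by (intro continuous_intros continuous_on_compose2[OF continuous_on_Xi[of UNIV]])
      (use tau_pos in auto)
  show "accumulation K 0 \<le> 0" if K: "K \<in> T" for K
    unfolding accumulation_def
    using m_pos[OF K] tau_pos rho_nonneg[OF K] Xi_nonpos(1)[of "\<rho> K" 0]
    by (auto intro!: mult_nonneg_nonpos divide_nonpos_pos)
  \<comment> \<open>The sum serves as a crude common upper bound for all the ratios
    \<open>\<rho> K / p K\<close>; above it, \<open>p K * t\<close> exceeds
    \<open>\<rho> K\<close>.\<close>
  show "0 < accumulation K t" if K: "K \<in> T" and t: "(\<Sum>K\<in>T. \<rho> K / p K) < t" for K t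
  proof -
    have "\<rho> K / p K \<le> (\<Sum>K\<in>T. \<rho> K / p K)"
      using K finite_T rho_nonneg p_pos
      by (intro member_le_sum) (auto simp: less_imp_le)
    then have "\<rho> K / p K < t" using t by simp
    then have "\<rho> K < p K * t"
      using p_pos[OF K] by (simp add: pos_divide_less_eq mult.commute)
    then show ?thesis
      using Xi_greater[OF rho_nonneg[OF K]] m_pos[OF K] tau_pos by (simp add: accumulation_def)
  qed
qed (use finite_T w_nonneg in auto)

text \<open>Applied with \<open>D = T\<close> for mass conservation, with the cells where
  \<open>u \<le> 0\<close> for positivity, and with those where one solution exceeds another for
  uniqueness.\<close>

lemma solution_sum_cut:
  assumes "solution u" "D \<subseteq> T"
  shows "(\<Sum>K\<in>D. accumulation K (u K)) + (\<Sum>K\<in>D. \<Sum>L\<in>T - D. w K L * (u K - u L)) = 0"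
proof -
  have "(\<Sum>K\<in>D. accumulation K (u K) + (\<Sum>L\<in>T. w K L * (u K - u L))) = 0"
    using assms by (intro sum.neutral) (auto simp: solution_def)
  then show ?thesis
    using sum_graph_laplacian_cut[of T D w u, OF finite_T assms(2) w_sym] by (simp add: sum.distrib)
qed

lemma solution_mass:
  assumes "solution u"
  shows "(\<Sum>K\<in>T. m K * Xi (\<rho> K) (p K * u K)) = (\<Sum>K\<in>T. m K * \<rho> K)"
proof -
  have "(\<Sum>K\<in>T. accumulation K (u K)) = 0" using solution_sum_cut[OF assms, of T] by simp
  moreover have "(\<Sum>K\<in>T. accumulation K (u K))
      = ((\<Sum>K\<in>T. m K * Xi (\<rho> K) (p K * u K)) - (\<Sum>K\<in>T. m K * \<rho> K)) / \<tau>"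
    by (simp add: accumulation_def sum_subtractf[symmetric] sum_divide_distrib right_diff_distrib
        diff_divide_distrib)
  ultimately show ?thesis using tau_pos by simp
qed

text \<open>Connectedness supplies one edge of positive weight across the cut; all other terms are
  nonnegative.\<close>

lemma cut_sum_pos:
  assumes "D \<subseteq> T" "D \<noteq> {}" "D \<noteq> T" and d: "\<And>K L. K \<in> D \<Longrightarrow> L \<in> T - D \<Longrightarrow> 0 < d K L"
  shows "0 < (\<Sum>K\<in>D. \<Sum>L\<in>T - D. w K L * d K L)"
proof -
  obtain K L where KL: "K \<in> D" "L \<in> T - D" "0 < w K L"
    using connected_graph[OF assms(1-3)] by blast
  have nn: "0 \<le> w K L * d K L" if "K \<in> D" "L \<in> T - D" for K L
    using that d w_nonneg assms(1) by (intro mult_nonneg_nonneg) (auto simp: less_imp_le)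
  have fin: "finite D" using assms(1) finite_T finite_subset by blast
  have "0 < (\<Sum>L\<in>T - D. w K L * d K L)"
    using KL nn d finite_T by (intro sum_pos2[of _ L]) auto
  then show ?thesis
    using KL nn by (intro sum_pos2[OF fin KL(1)] sum_nonneg) auto
qed

text \<open>Let \<open>D\<close> be the cells with \<open>u \<le> 0\<close>. There the accumulation
  is nonpositive, yet it must balance a strictly positive inflow through the cut unless
  \<open>D = T\<close>. In that case every accumulation term is 0, which forces
  \<open>\<rho> = 0\<close> on \<open>T\<close> and contradicts the positive mass.\<close>

lemma solution_pos:
  assumes u: "solution u" and K: "K \<in> T"
  shows "0 < u K"
proof (rule ccontr)
  assume "\<not> 0 < u K"
  define D where "D = {K \<in> T. u K \<le> 0}"
  have D: "D \<subseteq> T" "D \<noteq> {}" using K \<open>\<not> 0 < u K\<close> by (auto simp: D_def)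
  have pu: "p K * u K \<le> 0" if "K \<in> D" for K
    using that p_pos[of K] by (auto simp: D_def intro: mult_nonneg_nonpos)
  have nonpos: "accumulation K (u K) \<le> 0" if "K \<in> D" for K
  proof -
    have "K \<in> T" using that D by auto
    then have "Xi (\<rho> K) (p K * u K) \<le> \<rho> K"
      using Xi_nonpos(1)[OF rho_nonneg[OF \<open>K \<in> T\<close>] pu[OF that]] rho_nonneg[of K] by simp
    then show ?thesis
      using m_pos[OF \<open>K \<in> T\<close>] tau_pos
      by (auto simp: accumulation_def intro!: mult_nonneg_nonpos divide_nonpos_pos)
  qed
  have acc: "(\<Sum>K\<in>D. accumulation K (u K)) \<le> 0" using nonpos by (rule sum_nonpos)
  have eq: "(\<Sum>K\<in>D. accumulation K (u K)) = (\<Sum>K\<in>D. \<Sum>L\<in>T - D. w K L * (u L - u K))"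
    using solution_sum_cut[OF u D(1)]
    by (simp add: eq_neg_iff_add_eq_0[symmetric] sum_negf[symmetric] right_diff_distrib)
  show False
  proof (cases "D = T")
    case False
    have "0 < (\<Sum>K\<in>D. \<Sum>L\<in>T - D. w K L * (u L - u K))"
      using D False by (intro cut_sum_pos) (auto simp: D_def)
    then show False using acc eq by simp
  next
    case True
    then have "(\<Sum>K\<in>T. - accumulation K (u K)) = 0" using eq by (simp add: sum_negf)
    then have "\<forall>K\<in>T. accumulation K (u K) = 0"
      using nonpos True finite_T by (subst (asm) sum_nonneg_eq_0_iff) auto
    then have "\<rho> K = 0" if "K \<in> T" for K
      using that Xi_nonpos(2)[OF rho_nonneg pu, of K] m_pos[of K] tau_pos True
      by (auto simp: accumulation_def)
    then show False using mass_pos by simp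
  qed
qed

text \<open>The map \<open>Xi\<close> is flat only where it vanishes, and it cannot vanish everywhere because the mass
  is conserved.\<close>

lemma solution_le:
  assumes u: "solution u" and v: "solution v" and K: "K \<in> T"
  shows "u K \<le> v K"
proof (rule ccontr)
  assume "\<not> u K \<le> v K"
  \<comment> \<open>On \<open>D\<close> the accumulation difference is nonnegative. Across the cut
    \<open>u - v\<close> drops from a positive to a nonpositive value, so the outflow difference is
    strictly positive unless \<open>D = T\<close>.\<close>
  define D where "D = {K \<in> T. v K < u K}"
  have D: "D \<subseteq> T" "D \<noteq> {}" using K \<open>\<not> u K \<le> v K\<close> by (auto simp: D_def)
  have Xi_le: "Xi (\<rho> K) (p K * v K) \<le> Xi (\<rho> K) (p K * u K)" if "K \<in> D" for K
    using that p_pos by (intro Xi_mono) (auto simp: D_def)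
  have nonneg: "0 \<le> accumulation K (u K) - accumulation K (v K)" if "K \<in> D" for K
    using that Xi_le[OF that] m_pos[of K] tau_pos D
    by (auto simp: accumulation_def intro!: mult_left_mono divide_right_mono)
  have acc: "0 \<le> (\<Sum>K\<in>D. accumulation K (u K) - accumulation K (v K))"
    using nonneg by (rule sum_nonneg)
  have eq: "(\<Sum>K\<in>D. accumulation K (u K) - accumulation K (v K))
      + (\<Sum>K\<in>D. \<Sum>L\<in>T - D. w K L * ((u K - v K) - (u L - v L))) = 0"
  proof -
    have "w K L * ((u K - v K) - (u L - v L)) = w K L * (u K - u L) - w K L * (v K - v L)" for K L
      by (simp add: algebra_simps)
    then show ?thesis
      using solution_sum_cut[OF u D(1)] solution_sum_cut[OF v D(1)] by (simp add: sum_subtractf)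
  qed
  show False
  proof (cases "D = T")
    case False
    have "0 < (\<Sum>K\<in>D. \<Sum>L\<in>T - D. w K L * ((u K - v K) - (u L - v L)))"
      using D False by (intro cut_sum_pos) (auto simp: D_def)
    then show False using acc eq by simp
  next
    case True
    then have "(\<Sum>K\<in>T. accumulation K (u K) - accumulation K (v K)) = 0" using eq by simp
    then have acc_eq: "\<forall>K\<in>T. accumulation K (u K) - accumulation K (v K) = 0"
      using nonneg True finite_T by (subst (asm) sum_nonneg_eq_0_iff) auto
    have "Xi (\<rho> K) (p K * u K) = 0" if "K \<in> T" for K
    proof (rule Xi_eq_imp_0)
      show "p K * v K < p K * u K" using that True p_pos by (auto simp: D_def)
      show "Xi (\<rho> K) (p K * v K) = Xi (\<rho> K) (p K * u K)"
        using that acc_eq m_pos[of K] tau_pos by (auto simp: accumulation_def)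
    qed
    then show False using solution_mass[OF u] mass_pos by simp
  qed
qed

end

section \<open>Facets and cells\<close>

text \<open>One hyperplane serves all cells at once. It need not pass through \<open>y\<close>, so
  points away from every frontier count as flat too.\<close>

definition flat_point :: "'a::euclidean_space set set \<Rightarrow> 'a \<Rightarrow> bool" where
  "flat_point T y \<longleftrightarrow>
     (\<exists>r>0. \<exists>a b. a \<noteq> 0 \<and> (\<forall>K\<in>T. ball y r \<inter> frontier K \<subseteq> {z. a \<bullet> z = b}))"


lemma open_subset_hyperplane_empty:
  fixes a :: "'a::euclidean_space"
  assumes "open S" "a \<noteq> 0" "S \<subseteq> {z. a \<bullet> z = b}"
  shows "S = {}"
  using assms interior_hyperplane[OF assms(2)] interior_maximal by blast

text \<open>The hyperplane cuts the ball into two connected halves that avoid all frontiers, and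
  each cell touching \<open>y\<close> swallows a nonempty half. Two disjoint cells thus use up both
  halves, which are reflections of each other in \<open>y\<close>.\<close>

lemma flat_point_two_sided:
  assumes "flat_point T y" and op: "\<And>K. K \<in> T \<Longrightarrow> open K"
    and disj: "\<And>K L. K \<in> T \<Longrightarrow> L \<in> T \<Longrightarrow> K \<noteq> L \<Longrightarrow> K \<inter> L = {}"
    and KL: "K \<in> T" "L \<in> T" "K \<noteq> L" "y \<in> closure K" "y \<in> closure L"
  shows "\<And>M. M \<in> T \<Longrightarrow> y \<in> closure M \<Longrightarrow> M = K \<or> M = L"
    and "\<exists>z\<in>K. \<exists>v\<in>L. y = midpoint z v"
proof -
  obtain r a b where r: "r > 0" and a: "a \<noteq> 0"
    and fr: "\<forall>K\<in>T. ball y r \<inter> frontier K \<subseteq> {z. a \<bullet> z = b}"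
    using assms(1) unfolding flat_point_def by (elim exE conjE) (rule that)
  define P where "P = ball y r \<inter> {z. a \<bullet> z > b}"
  define N where "N = ball y r \<inter> {z. a \<bullet> z < b}"
  have conn: "connected P" "connected N"
    by (auto simp: P_def N_def intro!: convex_connected convex_Int convex_halfspace_gt convex_halfspace_lt)
  \<comment> \<open>The open set \<open>ball y r \<inter> M\<close> is nonempty, so it cannot lie in
    the hyperplane and meets a half. Nonemptiness of that half is recorded because an empty one
    would not separate disjoint cells.\<close>
  have side: "(P \<noteq> {} \<and> P \<subseteq> M) \<or> (N \<noteq> {} \<and> N \<subseteq> M)" if M: "M \<in> T" "y \<in> closure M" for M
  proof -
    have "ball y r \<inter> M \<noteq> {}"
      using M(2) r open_Int_closure_eq_empty[OF open_ball, of y r M] by (metis IntI centre_in_ball empty_iff)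
    then have "\<not> ball y r \<inter> M \<subseteq> {z. a \<bullet> z = b}"
      using open_subset_hyperplane_empty[of "ball y r \<inter> M" a b] a op[OF M(1)] by auto
    then have "P \<inter> M \<noteq> {} \<or> N \<inter> M \<noteq> {}" by (force simp: P_def N_def)
    moreover have "P \<inter> frontier M = {}" "N \<inter> frontier M = {}"
      using bspec[OF fr M(1)] by (auto simp: P_def N_def)
    ultimately show ?thesis
      using connected_Int_frontier[OF conn(1), of M] connected_Int_frontier[OF conn(2), of M] by blast
  qed
  have KLd: "K \<inter> L = {}" using disj KL by blast
  then have PN: "P \<noteq> {}" "N \<noteq> {}" "P \<subseteq> K \<and> N \<subseteq> L \<or> P \<subseteq> L \<and> N \<subseteq> K"
    using side[OF KL(1,4)] side[OF KL(2,5)] by blast+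
  show "M = K \<or> M = L" if M: "M \<in> T" "y \<in> closure M" for M
  proof -
    have "M \<inter> K \<noteq> {} \<or> M \<inter> L \<noteq> {}" using side[OF M] PN(3) by (elim disjE conjE) blast+
    then show ?thesis using disj[OF M(1) KL(1)] disj[OF M(1) KL(2)] by argo
  qed
  \<comment> \<open>Lying in \<open>closure L\<close>, the point cannot be in the open set
    \<open>K\<close>; hence it is on the hyperplane, and a normal step of length
    \<open>r / 2\<close> either way stays in the ball.\<close>
  have "y \<in> frontier K"
    using KL op[OF KL(1)] KLd open_Int_closure_eq_empty[of K L]
    by (auto simp: frontier_def interior_open)
  then have y: "a \<bullet> y = b" using bspec[OF fr KL(1)] r centre_in_ball by blast
  define e where "e = (r / (2 * norm a)) *\<^sub>R a"
  have e: "norm e < r" "a \<bullet> e > 0" using a r by (auto simp: e_def)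
  then have "y + e \<in> P" "y - e \<in> N"
    using y by (auto simp: P_def N_def dist_norm inner_add_right inner_diff_right)
  moreover have "y = midpoint (y + e) (y - e)" "y = midpoint (y - e) (y + e)"
    by (auto simp: midpoint_def algebra_simps simp flip: scaleR_2)
  ultimately show "\<exists>z\<in>K. \<exists>v\<in>L. y = midpoint z v"
    using PN(3) by blast
qed

lemma cylinder_UN: "cylinder u (\<Union>i\<in>I. S i) = (\<Union>i\<in>I. cylinder u (S i))"
  unfolding cylinder_def by blast

text \<open>A parallel hyperplane distinct from the one carrying \<open>\<sigma>\<close> misses it.
  Otherwise the section has two independent unit normals, which is the case of
  \<open>negligible_cylinder\<close>.\<close>

lemma negligible_cylinder_hyperplane_section:
  assumes n: "unit_normal \<sigma> n" "\<sigma> \<subseteq> {y. n \<bullet> y = c}" and a: "a \<noteq> 0"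
    and ne: "{y. a \<bullet> y = b} \<noteq> {y. n \<bullet> y = c}"
  shows "negligible (cylinder n (\<sigma> \<inter> {y. a \<bullet> y = b}))"
proof (cases "a /\<^sub>R norm a = n \<or> a /\<^sub>R norm a = - n")
  case True
  have "a = norm a *\<^sub>R (a /\<^sub>R norm a)" using a by simp
  then have "a = norm a *\<^sub>R n \<or> a = (- norm a) *\<^sub>R n"
    using True by (metis scaleR_minus_left scaleR_minus_right)
  then obtain s where s: "s \<noteq> 0" "a = s *\<^sub>R n"
    using a by (metis neg_equal_0_iff_equal norm_eq_zero)
  have "\<sigma> \<inter> {y. a \<bullet> y = b} = {}"
  proof (rule ccontr)
    assume "\<sigma> \<inter> {y. a \<bullet> y = b} \<noteq> {}"
    then have "b = s * c" using n(2) s by auto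
    then show False using ne s by simp
  qed
  then show ?thesis by (simp add: cylinder_def)
next
  case False
  have "unit_normal (\<sigma> \<inter> {y. a \<bullet> y = b}) (a /\<^sub>R norm a)"
    using a by (auto simp: unit_normal_def)
  moreover have "unit_normal (\<sigma> \<inter> {y. a \<bullet> y = b}) n"
    using n by (auto simp: unit_normal_def)
  ultimately show ?thesis using False by (intro negligible_cylinder) auto
qed

text \<open>The finitely many closed members of \<open>H\<close> that miss \<open>y\<close> also
  miss a ball around it, so in that ball the frontiers see only the one hyperplane through
  \<open>y\<close>, if any.\<close>

lemma flat_point_if_off_hyperplanes:
  assumes H: "finite H" "\<And>h. h \<in> H \<Longrightarrow> closed h" and fr: "\<And>K. K \<in> T \<Longrightarrow> frontier K \<subseteq> \<Union>H"
    and a: "a \<noteq> 0" and off: "\<And>h. h \<in> H \<Longrightarrow> y \<in> h \<Longrightarrow> h = {z. a \<bullet> z = b}"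
  shows "flat_point T y"
proof -
  have "open (- \<Union>{h \<in> H. y \<notin> h})"
    using H by (intro open_Compl closed_Union) auto
  then obtain r where "r > 0" and r: "ball y r \<subseteq> - \<Union>{h \<in> H. y \<notin> h}"
    by (metis (no_types, lifting) ComplI UnionE mem_Collect_eq openE)
  have "ball y r \<inter> frontier K \<subseteq> {z. a \<bullet> z = b}" if "K \<in> T" for K
    using fr[OF that] r off by blast
  then show ?thesis
    unfolding flat_point_def using a \<open>r > 0\<close> by (intro exI[of _ r] exI[of _ a] exI[of _ b] conjI ballI)
qed

section \<open>Neighbouring cells of a mesh of a convex domain\<close>

locale convex_admissible_mesh = admissible_mesh \<Omega> T E EK x
  for \<Omega> :: "'a::euclidean_space set" and T E EK x +
  assumes convex_domain: "convex \<Omega>" and open_domain: "open \<Omega>"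
begin

lemma open_cell: "K \<in> T \<Longrightarrow> open K"
  using cells_polyhedral by (simp add: polyhedral_open_def)

text \<open>The cover only puts cells inside \<open>closure \<Omega>\<close>; an open convex set is
  the interior of its closure.\<close>

lemma cell_subset_domain:
  assumes "K \<in> T"
  shows "K \<subseteq> \<Omega>"
proof -
  have "K \<subseteq> closure \<Omega>" using assms cells_cover closure_subset by blast
  then have "K \<subseteq> interior (closure \<Omega>)" using assms open_cell interior_maximal by blast
  then show ?thesis
    using convex_interior_closure[OF convex_domain] open_domain by (simp add: interior_open)
qed

lemma obtain_hyperplanes:
  obtains H :: "'a set set" and A B where "finite H"
    and "\<And>h. h \<in> H \<Longrightarrow> A h \<noteq> 0" and "\<And>h y. h \<in> H \<Longrightarrow> y \<in> h \<longleftrightarrow> A h \<bullet> y = B h"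
    and "\<And>K. K \<in> T \<Longrightarrow> frontier K \<subseteq> \<Union>H"
proof -
  have "\<forall>K\<in>T. \<exists>H. finite H \<and> (\<forall>h\<in>H. \<exists>a b. a \<noteq> 0 \<and> h = {y. a \<bullet> y = b}) \<and> frontier K \<subseteq> \<Union>H"
    using cells_polyhedral by (simp add: polyhedral_open_def)
  then obtain HK where HK: "\<And>K. K \<in> T \<Longrightarrow> finite (HK K)"
    "\<And>K h. K \<in> T \<Longrightarrow> h \<in> HK K \<Longrightarrow> \<exists>a b. a \<noteq> 0 \<and> h = {y. a \<bullet> y = b}"
    "\<And>K. K \<in> T \<Longrightarrow> frontier K \<subseteq> \<Union>(HK K)"
    by metis
  define H where "H = (\<Union>K\<in>T. HK K)"
  have "\<forall>h\<in>H. \<exists>a b. a \<noteq> 0 \<and> h = {y. a \<bullet> y = b}" using HK(2) by (auto simp: H_def)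
  then obtain A B where AB: "\<And>h. h \<in> H \<Longrightarrow> A h \<noteq> 0 \<and> h = {y. A h \<bullet> y = B h}" by metis
  show ?thesis
  proof (rule that[of H A B])
    show "finite H" using HK(1) finite_cells by (simp add: H_def)
    show "frontier K \<subseteq> \<Union>H" if "K \<in> T" for K
      using HK(3)[OF that] that unfolding H_def by blast
  qed (use AB in blast)+
qed

text \<open>Every hyperplane other than the one carrying \<open>\<sigma>\<close> meets it in a null
  set. Finitely many such sets cannot exhaust a facet of positive measure.\<close>

lemma facet_flat_point:
  assumes "\<sigma> \<in> E"
  obtains y where "y \<in> \<sigma>" "flat_point T y"
proof -
  obtain H :: "'a set set" and A B where H: "finite H" "\<And>h. h \<in> H \<Longrightarrow> A h \<noteq> 0"
    "\<And>h y. h \<in> H \<Longrightarrow> y \<in> h \<longleftrightarrow> A h \<bullet> y = B h" "\<And>K. K \<in> T \<Longrightarrow> frontier K \<subseteq> \<Union>H"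
    by (rule obtain_hyperplanes) blast
  have eqH: "{y. A h \<bullet> y = B h} = h" if "h \<in> H" for h using H(3)[OF that] by blast
  obtain a b where a: "a \<noteq> 0" "\<sigma> \<subseteq> {y. a \<bullet> y = b}" using facets_hyperplane[OF assms] by blast
  define n where "n = a /\<^sub>R norm a"
  have n: "n \<noteq> 0" "\<sigma> \<subseteq> {y. n \<bullet> y = b / norm a}"
    using a by (auto simp: n_def divide_inverse_commute)
  then have un: "unit_normal \<sigma> n" using a by (auto simp: unit_normal_def n_def)
  have "\<exists>y\<in>\<sigma>. \<forall>h\<in>H. y \<in> h \<longrightarrow> h = {z. n \<bullet> z = b / norm a}"
  proof (rule ccontr)
    assume neg: "\<not> ?thesis"
    define I where "I = {h \<in> H. h \<noteq> {z. n \<bullet> z = b / norm a}}"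
    have "\<sigma> = (\<Union>h\<in>I. \<sigma> \<inter> h)" using neg by (auto simp: I_def)
    then have "cylinder n \<sigma> = (\<Union>h\<in>I. cylinder n (\<sigma> \<inter> h))" using cylinder_UN by metis
    moreover have "negligible (cylinder n (\<sigma> \<inter> h))" if "h \<in> I" for h
      using negligible_cylinder_hyperplane_section[OF un n(2) H(2), of h "B h"] eqH[of h] that
      by (auto simp: I_def)
    ultimately have "negligible (cylinder n \<sigma>)"
      using H(1) by (auto simp: I_def intro!: negligible_Union)
    then show False
      using facet_measure_eq[OF un] facets_measure_pos[OF assms] by (simp add: negligible_imp_measure0)
  qed
  then obtain y where y: "y \<in> \<sigma>" "\<And>h. h \<in> H \<Longrightarrow> y \<in> h \<Longrightarrow> h = {z. n \<bullet> z = b / norm a}" by blast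
  have "flat_point T y"
  proof (rule flat_point_if_off_hyperplanes[OF H(1) _ H(4) n(1)])
    show "closed h" if "h \<in> H" for h
      using closed_hyperplane[of "A h" "B h"] eqH[OF that] by simp
  qed (use y in auto)
  then show ?thesis using that y by blast
qed

text \<open>A flat point of the facet would lie in the closures of all three cells, but it touches
  at most two.\<close>

lemma interior_facet_cells:
  assumes K: "K \<in> T" "L \<in> T" "K \<noteq> L" "frontier K \<inter> frontier L \<in> E"
    and M: "M \<in> T" "frontier K \<inter> frontier L \<subseteq> frontier M"
  shows "M = K \<or> M = L"
proof -
  obtain y where y: "y \<in> frontier K \<inter> frontier L" "flat_point T y"
    using facet_flat_point[OF K(4)] by blast
  then show ?thesis
    using flat_point_two_sided(1)[OF y(2) open_cell cells_disjoint K(1-3), of M] M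
    by (auto simp: frontier_def)
qed

text \<open>As the midpoint of points of two cells, \<open>y\<close> is in \<open>\<Omega>\<close>
  by convexity, so a facet of \<open>K\<close> through it is no boundary facet. It is then shared by
  \<open>K\<close> and some other cell touching \<open>y\<close>, and only \<open>L\<close>
  qualifies.\<close>

lemma flat_point_between_cells:
  assumes KL: "K \<in> T" "L \<in> T" "K \<noteq> L" and y: "flat_point T y" "y \<in> closure K" "y \<in> closure L"
  shows "y \<in> \<Omega>" and "frontier K \<inter> frontier L \<in> EK K"
proof -
  note two = flat_point_two_sided[OF y(1) open_cell cells_disjoint KL y(2,3)]
  obtain z v where zv: "z \<in> K" "v \<in> L" "y = midpoint z v" using two(2) by blast
  then have "closed_segment z v \<subseteq> \<Omega>"
    using cell_subset_domain KL convex_domain by (meson closed_segment_subset subsetD)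
  then show "y \<in> \<Omega>" using zv midpoint_in_closed_segment by blast
  then have bd: "y \<notin> frontier \<Omega>" using open_domain by (simp add: frontier_def interior_open)
  have "y \<in> frontier K"
    using KL y open_cell[OF KL(1)] cells_disjoint[OF KL] open_Int_closure_eq_empty[of K L]
    by (auto simp: frontier_def interior_open)
  then obtain \<sigma> where \<sigma>: "\<sigma> \<in> EK K" "y \<in> \<sigma>" using cell_frontier[OF KL(1)] by auto
  then have "\<sigma> \<in> E" "\<sigma> \<subseteq> frontier K"
    using cell_facets_subset[OF KL(1)] cell_frontier[OF KL(1)] by auto
  then have "\<sigma> \<in> interior_facets T E" using facets_interior_or_boundary[of \<sigma>] bd \<sigma> by blast
  then obtain K' L' where K': "K' \<in> T" "L' \<in> T" "K' \<noteq> L'" "\<sigma> = frontier K' \<inter> frontier L'"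
    by (auto simp: interior_facets_def)
  have "K = K' \<or> K = L'"
    using interior_facet_cells[OF K'(1-3), of K] K'(4) \<open>\<sigma> \<in> E\<close> \<open>\<sigma> \<subseteq> frontier K\<close> KL(1) by blast
  then obtain J where J: "J \<in> T" "J \<noteq> K" "\<sigma> = frontier K \<inter> frontier J" using K' by blast
  then have "J = L" using two(1)[of J] \<sigma>(2) by (auto simp: frontier_def)
  then show "frontier K \<inter> frontier L \<in> EK K" using J \<sigma> by simp
qed

text \<open>Membership in \<open>E\<close> says only that some cell lists the facet. A flat point on
  it shows that \<open>K\<close> does; by symmetry so does \<open>L\<close>.\<close>

lemma interior_facet_mem_cell_facets:
  assumes "K \<in> T" "L \<in> T" "K \<noteq> L" "frontier K \<inter> frontier L \<in> E"
  shows "frontier K \<inter> frontier L \<in> EK K"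
proof -
  obtain y where "y \<in> frontier K \<inter> frontier L" "flat_point T y"
    using facet_flat_point[OF assms(4)] by blast
  then show ?thesis
    using flat_point_between_cells(2)[OF assms(1-3)] by (simp add: frontier_def)
qed

lemma other_cell_eq:
  assumes "K \<in> T" "L \<in> T" "L \<noteq> K" "frontier K \<inter> frontier L \<in> E"
  shows "other_cell T K (frontier K \<inter> frontier L) = L"
  unfolding other_cell_def
proof (rule the_equality)
  fix M assume "M \<in> T \<and> M \<noteq> K \<and> frontier K \<inter> frontier L = frontier K \<inter> frontier M"
  then show "M = L" using interior_facet_cells[of K L M] assms by blast
qed (use assms in auto)

lemma cell_interior_facet:
  assumes "K \<in> T" "\<sigma> \<in> EK K \<inter> interior_facets T E"
  obtains L where "L \<in> T" "L \<noteq> K" "\<sigma> = frontier K \<inter> frontier L"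
proof -
  obtain K' L' where K': "K' \<in> T" "L' \<in> T" "K' \<noteq> L'" "\<sigma> = frontier K' \<inter> frontier L'" "\<sigma> \<in> E"
    using assms by (auto simp: interior_facets_def)
  moreover have "\<sigma> \<subseteq> frontier K" using cell_frontier assms by auto
  ultimately have "K = K' \<or> K = L'" using interior_facet_cells[of K' L' K] assms(1) by blast
  then show ?thesis using that K' by blast
qed

text \<open>Interior facets of \<open>K\<close> correspond bijectively to its neighbours. Extension
  by 0 turns the facet sum into the sum over all cells required by the graph Laplacian.\<close>

lemma sum_interior_facets:
  assumes K: "K \<in> T"
  shows "(\<Sum>\<sigma>\<in>EK K \<inter> interior_facets T E. f \<sigma> (other_cell T K \<sigma>)) =
    (\<Sum>L\<in>T. if L \<noteq> K \<and> frontier K \<inter> frontier L \<in> E then f (frontier K \<inter> frontier L) L else 0)"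
proof -
  have "(\<Sum>\<sigma>\<in>EK K \<inter> interior_facets T E. f \<sigma> (other_cell T K \<sigma>)) =
    (\<Sum>L\<in>{L \<in> T. L \<noteq> K \<and> frontier K \<inter> frontier L \<in> E}. f (frontier K \<inter> frontier L) L)"
  proof (rule sum.reindex_bij_witness[where j = "other_cell T K" and i = "\<lambda>L. frontier K \<inter> frontier L"])
    fix \<sigma> assume \<sigma>: "\<sigma> \<in> EK K \<inter> interior_facets T E"
    then obtain L where L: "L \<in> T" "L \<noteq> K" "\<sigma> = frontier K \<inter> frontier L"
      using cell_interior_facet[OF K] by blast
    have "\<sigma> \<in> E" using \<sigma> by (auto simp: interior_facets_def)
    then have "other_cell T K \<sigma> = L" using other_cell_eq[OF K] L by simp
    then show "frontier K \<inter> frontier (other_cell T K \<sigma>) = \<sigma>"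
      "other_cell T K \<sigma> \<in> {L \<in> T. L \<noteq> K \<and> frontier K \<inter> frontier L \<in> E}"
      "f (frontier K \<inter> frontier (other_cell T K \<sigma>)) (other_cell T K \<sigma>) = f \<sigma> (other_cell T K \<sigma>)"
      using L \<open>\<sigma> \<in> E\<close> by auto
  next
    fix L assume L: "L \<in> {L \<in> T. L \<noteq> K \<and> frontier K \<inter> frontier L \<in> E}"
    then show "other_cell T K (frontier K \<inter> frontier L) = L" using other_cell_eq[OF K] by simp
    show "frontier K \<inter> frontier L \<in> EK K \<inter> interior_facets T E"
      using L K interior_facet_mem_cell_facets[OF K, of L] by (auto simp: interior_facets_def)
  qed
  then show ?thesis
    using finite_cells by (simp add: sum.inter_filter)
qed

text \<open>The segment joining \<open>p\<close> to a generic \<open>q\<close> meets the hyperplanes of the cells one at a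
  time, so it consists of flat points.\<close>

lemma adjacent_cells_across_cut:
  assumes D: "D \<subseteq> T" "D \<noteq> {}" "D \<noteq> T"
  shows "\<exists>K\<in>D. \<exists>L\<in>T - D. frontier K \<inter> frontier L \<in> E"
proof -
  obtain H :: "'a set set" and A B where H: "finite H" "\<And>h. h \<in> H \<Longrightarrow> A h \<noteq> 0"
    "\<And>h y. h \<in> H \<Longrightarrow> y \<in> h \<longleftrightarrow> A h \<bullet> y = B h" "\<And>K. K \<in> T \<Longrightarrow> frontier K \<subseteq> \<Union>H"
    by (rule obtain_hyperplanes) blast
  have eqH: "{y. A h \<bullet> y = B h} = h" if "h \<in> H" for h using H(3)[OF that] by blast
  \<comment> \<open>A cell has positive measure, so finitely many null sets do not cover it.\<close>
  have generic: "\<exists>y\<in>K. y \<notin> \<Union>\<N>"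
    if "K \<in> T" "finite \<N>" "\<And>N. N \<in> \<N> \<Longrightarrow> negligible N" for K \<N>
  proof (rule ccontr)
    assume "\<not> ?thesis"
    then have "K \<subseteq> \<Union>\<N>" by blast
    then have "negligible K" using negligible_Union that negligible_subset by metis
    then show False using cells_measure_pos[OF that(1)] by (simp add: negligible_imp_measure0)
  qed
  obtain K0 L0 where K0: "K0 \<in> D" "K0 \<in> T" and L0: "L0 \<in> T" "L0 \<notin> D" using D by blast
  have negH: "negligible h" if "h \<in> H" for h
    using negligible_hyperplane[of "A h" "B h"] H(2)[OF that] eqH[OF that] by simp
  obtain p where p: "p \<in> K0" "p \<notin> \<Union>H" using generic[OF K0(2) H(1) negH] by blast
  \<comment> \<open>If \<open>p + t *\<^sub>R (q - p)\<close> lies in both \<open>h\<close> and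
    \<open>k\<close>, eliminating \<open>t\<close> from the two equations shows that
    \<open>c h k\<close> is orthogonal to \<open>q - p\<close>. So \<open>\<N>\<close> collects the
    bad positions of \<open>q\<close>.\<close>
  define c where "c = (\<lambda>h k. (B k - A k \<bullet> p) *\<^sub>R A h - (B h - A h \<bullet> p) *\<^sub>R A k)"
  define \<N> where "\<N> = (\<lambda>(h, k). {q. c h k \<bullet> q = c h k \<bullet> p}) ` {(h, k) \<in> H \<times> H. h \<noteq> k}"
  \<comment> \<open>If \<open>c h k\<close> vanished, the equations of \<open>h\<close> and
    \<open>k\<close> relative to \<open>p\<close> would be proportional with nonzero factors,
    because \<open>p\<close> is off both; then \<open>h = k\<close>.\<close>
  have c: "c h k \<noteq> 0" if hk: "h \<in> H" "k \<in> H" "h \<noteq> k" for h k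
  proof
    assume "c h k = 0"
    then have eq: "(B k - A k \<bullet> p) *\<^sub>R A h = (B h - A h \<bullet> p) *\<^sub>R A k" by (simp add: c_def)
    have nz: "B k - A k \<bullet> p \<noteq> 0" "B h - A h \<bullet> p \<noteq> 0"
      using p(2) H(3)[OF hk(1), of p] H(3)[OF hk(2), of p] hk by auto
    have "A h \<bullet> z = B h \<longleftrightarrow> A k \<bullet> z = B k" for z
    proof -
      have "(B k - A k \<bullet> p) * (A h \<bullet> (z - p)) = (B h - A h \<bullet> p) * (A k \<bullet> (z - p))"
        using arg_cong[OF eq, of "\<lambda>v. v \<bullet> (z - p)"] by simp
      moreover have "A h \<bullet> z = B h \<longleftrightarrow> A h \<bullet> (z - p) = B h - A h \<bullet> p"
        "A k \<bullet> z = B k \<longleftrightarrow> A k \<bullet> (z - p) = B k - A k \<bullet> p"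
        by (auto simp: inner_diff_right)
      ultimately show ?thesis using nz by (metis mult.commute mult_cancel_left)
    qed
    then show False using hk H(3) by blast
  qed
  have "finite \<N>" unfolding \<N>_def using H(1) by (intro finite_imageI) (auto intro: finite_subset)
  moreover have "negligible N" if "N \<in> \<N>" for N
    using that c by (auto simp: \<N>_def intro!: negligible_hyperplane)
  ultimately obtain q where q: "q \<in> L0" "q \<notin> \<Union>\<N>" using generic[OF L0(1)] by blast
  have flat: "flat_point T y" if y: "y \<in> closed_segment p q" for y
  proof -
    obtain t where t: "y = p + t *\<^sub>R (q - p)" "0 \<le> t" "t \<le> 1"
      using y by (auto simp: in_segment algebra_simps)
    have unique: "h = k" if hk: "h \<in> H" "k \<in> H" "y \<in> h" "y \<in> k" for h k
    proof (rule ccontr)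
      assume "h \<noteq> k"
      have "A h \<bullet> y = B h" "A k \<bullet> y = B k" using hk H(3) by auto
      then have "B h - A h \<bullet> p = t * (A h \<bullet> (q - p))" "B k - A k \<bullet> p = t * (A k \<bullet> (q - p))"
        using t by (auto simp: inner_add_right)
      then have "t * (c h k \<bullet> (q - p)) = 0" by (simp add: c_def inner_diff_left)
      moreover have "t \<noteq> 0" using t p hk by auto
      ultimately have "q \<in> \<Union>\<N>"
        using hk \<open>h \<noteq> k\<close> by (auto simp: \<N>_def inner_diff_right)
      then show False using q by simp
    qed
    have cl: "closed h" if "h \<in> H" for h
      using closed_hyperplane[of "A h" "B h"] eqH[OF that] by simp
    show ?thesis
    proof (cases "\<exists>h\<in>H. y \<in> h")
      case True
      then obtain h where h: "h \<in> H" "y \<in> h" by blast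
      show ?thesis
        by (rule flat_point_if_off_hyperplanes[OF H(1) cl H(4) H(2)[OF h(1)]])
          (use unique h eqH[OF h(1)] in auto)
    next
      case False
      \<comment> \<open>No hyperplane passes through \<open>y\<close>, so any nonzero normal will
        do.\<close>
      obtain a :: 'a where "a \<noteq> 0" using nonempty_Basis nonzero_Basis by blast
      with False show ?thesis
        by (intro flat_point_if_off_hyperplanes[OF H(1) cl H(4)]) auto
    qed
  qed
  \<comment> \<open>Two closed sets that cover a connected segment and both meet it have a common
    point on it, where a cell of \<open>D\<close> touches one outside \<open>D\<close>.\<close>
  define X where "X = (\<Union>K\<in>D. closure K)"
  define Y where "Y = (\<Union>K\<in>T - D. closure K)"
  have "closed X" "closed Y"
    unfolding X_def Y_def using finite_cells D(1) finite_subset by blast+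
  moreover have "closed_segment p q \<subseteq> X \<union> Y"
  proof -
    have "closed_segment p q \<subseteq> \<Omega>"
      using p q K0 L0 cell_subset_domain convex_domain by (meson closed_segment_subset subsetD)
    also have "\<dots> \<subseteq> X \<union> Y"
      using cells_cover closure_subset[of \<Omega>] unfolding X_def Y_def by blast
    finally show ?thesis .
  qed
  moreover have "p \<in> X" "q \<in> Y"
    using p(1) q(1) K0 L0 closure_subset[of K0] closure_subset[of L0] unfolding X_def Y_def by blast+
  ultimately have "X \<inter> Y \<inter> closed_segment p q \<noteq> {}"
    using connected_closedD[OF connected_segment(1), of X Y p q] by blast
  then obtain y where y: "y \<in> closed_segment p q" "y \<in> X" "y \<in> Y" by blast
  then obtain K L where KL: "K \<in> D" "y \<in> closure K" "L \<in> T - D" "y \<in> closure L"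
    by (auto simp: X_def Y_def)
  then have "frontier K \<inter> frontier L \<in> EK K"
    using flat_point_between_cells(2)[of K L y] flat[OF y(1)] D(1) by blast
  then have "frontier K \<inter> frontier L \<in> E" using cell_facets_subset KL D(1) by blast
  then show ?thesis using KL by blast
qed

end

section \<open>Existence and uniqueness for one time step\<close>

context convex_admissible_mesh
begin

text \<open>The symmetric edge weight of the graph of cells: the coefficient of the flux in
  \<open>\<theta> / \<pi>\<close> times the facet measure, extended by 0 to pairs without a common
  facet.\<close>

definition transmissibility :: "('a \<Rightarrow> real) \<Rightarrow> 'a set \<Rightarrow> 'a set \<Rightarrow> real" where
  "transmissibility V K L =
     (if L \<noteq> K \<and> frontier K \<inter> frontier L \<in> E
      then facet_measure (frontier K \<inter> frontier L) *
             (sqrt (gibbs V x K * gibbs V x L) / norm (x K - x L))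
      else 0)"

lemma transmissibility_pos:
  assumes "K \<in> T" "L \<in> T" "L \<noteq> K" "frontier K \<inter> frontier L \<in> E"
  shows "0 < transmissibility V K L"
  using assms facets_measure_pos[OF assms(4)] centers_eq_iff[of K L]
  by (auto simp: transmissibility_def gibbs_def)

lemma graph_scheme_mesh:
  assumes "0 < \<tau>" "\<forall>K\<in>T. 0 \<le> \<rho> K" "0 < (\<Sum>K\<in>T. measure lebesgue K * \<rho> K)"
  shows "graph_scheme T (transmissibility V) (measure lebesgue) (gibbs V x) \<rho> \<tau>"
proof
  show "transmissibility V K L = transmissibility V L K" for K L
    by (auto simp: transmissibility_def Int_commute mult.commute norm_minus_commute)
  show "0 \<le> transmissibility V K L" if "K \<in> T" "L \<in> T" for K L
    using transmissibility_pos[of K L V] that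
    by (cases "L \<noteq> K \<and> frontier K \<inter> frontier L \<in> E") (auto simp: transmissibility_def less_imp_le)
  show "\<exists>K\<in>D. \<exists>L\<in>T - D. 0 < transmissibility V K L" if D: "D \<subseteq> T" "D \<noteq> {}" "D \<noteq> T" for D
  proof -
    obtain K L where KL: "K \<in> D" "L \<in> T - D" "frontier K \<inter> frontier L \<in> E"
      using adjacent_cells_across_cut[OF D] by blast
    then have "0 < transmissibility V K L" using D by (intro transmissibility_pos) auto
    then show ?thesis using KL by blast
  qed
qed (use assms finite_cells cells_measure_pos in \<open>auto simp: gibbs_def\<close>)

lemma sum_flux:
  assumes "K \<in> T"
  shows "(\<Sum>\<sigma>\<in>EK K \<inter> interior_facets T E.
             facet_measure \<sigma> * flux V x \<theta> K (other_cell T K \<sigma>)) =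
    (\<Sum>L\<in>T. transmissibility V K L * (\<theta> K / gibbs V x K - \<theta> L / gibbs V x L))"
  unfolding sum_interior_facets[OF assms, of "\<lambda>\<sigma> L. facet_measure \<sigma> * flux V x \<theta> K L"]
  by (intro sum.cong) (auto simp: transmissibility_def flux_def)

end

text \<open>The unknowns range over \<open>T \<rightarrow>\<^sub>E UNIV\<close>, whose members are
  determined by their values on \<open>T\<close>, so uniqueness concerns only those values.\<close>

theorem proposition3p1:
  fixes \<Omega> :: "'a::euclidean_space set"
    and V :: "'a \<Rightarrow> real"
    and T :: "'a set set"
    and E :: "'a set set"
    and EK :: "'a set \<Rightarrow> 'a set set"
    and x :: "'a set \<Rightarrow> 'a"
    and \<tau> :: real
    and \<rho> :: "'a set \<Rightarrow> real"
  assumes "bounded \<Omega>" and "convex \<Omega>" and "polyhedral_open \<Omega>"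
    and "C2_closure \<Omega> V"
    and "admissible_mesh \<Omega> T E EK x"
    and "\<tau> > 0"
    and "\<forall>K\<in>T. \<rho> K \<ge> 0"
    and "(\<Sum>K\<in>T. measure lebesgue K * \<rho> K) > 0"
  shows "(\<exists>!p. p \<in> (T \<rightarrow>\<^sub>E UNIV) \<times> (T \<rightarrow>\<^sub>E UNIV) \<and>
             scheme_step T E EK x V \<tau> \<rho> (fst p) (snd p)) \<and>
         (\<forall>\<theta>\<in>T \<rightarrow>\<^sub>E UNIV. \<forall>\<rho>'\<in>T \<rightarrow>\<^sub>E UNIV. scheme_step T E EK x V \<tau> \<rho> \<theta> \<rho>' \<longrightarrow>
            (\<forall>K\<in>T. \<theta> K > 0 \<and> \<rho>' K \<ge> 0) \<and>
            (\<Sum>K\<in>T. measure lebesgue K * \<rho>' K) = (\<Sum>K\<in>T. measure lebesgue K * \<rho> K) \<and>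
            (\<forall>K\<in>T. (\<rho>' K + \<rho> K) / 2 \<ge> \<theta> K \<and> \<theta> K \<ge> min (\<rho>' K) (\<rho> K)))"
proof -
  interpret admissible_mesh \<Omega> T E EK x by fact
  interpret convex_admissible_mesh \<Omega> T E EK x
    using assms by unfold_locales (auto simp: polyhedral_open_def)
  interpret graph_scheme T "transmissibility V" "measure lebesgue" "gibbs V x" \<rho> \<tau>
    using assms by (intro graph_scheme_mesh)
  define u where "u = (\<lambda>\<theta> K. \<theta> K / gibbs V x K)"
  have p_u: "gibbs V x K * u \<theta> K = \<theta> K" for \<theta> K by (simp add: u_def gibbs_def)
  \<comment> \<open>The second equation of the scheme gives \<open>\<rho>'\<close> explicitly, and
    eliminating it leaves the graph equation for \<open>\<theta> / \<pi>\<close> alone.\<close>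
  have step_iff: "scheme_step T E EK x V \<tau> \<rho> \<theta> \<rho>' \<longleftrightarrow>
      solution (u \<theta>) \<and> (\<forall>K\<in>T. \<rho>' K = Xi (\<rho> K) (\<theta> K))" for \<theta> \<rho>'
  proof -
    have "solution (u \<theta>) \<longleftrightarrow> (\<forall>K\<in>T. measure lebesgue K * ((Xi (\<rho> K) (\<theta> K) - \<rho> K) / \<tau>) +
        (\<Sum>\<sigma>\<in>EK K \<inter> interior_facets T E.
           facet_measure \<sigma> * flux V x \<theta> K (other_cell T K \<sigma>)) = 0)"
      by (simp add: solution_def accumulation_def sum_flux p_u) (simp add: u_def)
    then show ?thesis by (auto simp: scheme_step_def)
  qed
  show ?thesis
  proof (intro conjI ballI impI)
    obtain v where v: "solution v" using solution_exists by blast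
    define \<theta> where "\<theta> = (\<lambda>K\<in>T. gibbs V x K * v K)"
    define \<rho>' where "\<rho>' = (\<lambda>K\<in>T. Xi (\<rho> K) (\<theta> K))"
    have "u \<theta> K = v K" if "K \<in> T" for K using that by (simp add: u_def \<theta>_def gibbs_def)
    then have "solution (u \<theta>)" using v by (simp add: solution_def)
    show "\<exists>!q. q \<in> (T \<rightarrow>\<^sub>E UNIV) \<times> (T \<rightarrow>\<^sub>E UNIV) \<and> scheme_step T E EK x V \<tau> \<rho> (fst q) (snd q)"
    proof (rule ex1I[of _ "(\<theta>, \<rho>')"])
      show "(\<theta>, \<rho>') \<in> (T \<rightarrow>\<^sub>E UNIV) \<times> (T \<rightarrow>\<^sub>E UNIV) \<and>
          scheme_step T E EK x V \<tau> \<rho> (fst (\<theta>, \<rho>')) (snd (\<theta>, \<rho>'))"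
        using \<open>solution (u \<theta>)\<close> by (simp add: step_iff) (simp add: \<theta>_def \<rho>'_def)
    next
      fix q assume q: "q \<in> (T \<rightarrow>\<^sub>E UNIV) \<times> (T \<rightarrow>\<^sub>E UNIV) \<and>
          scheme_step T E EK x V \<tau> \<rho> (fst q) (snd q)"
      then have sol: "solution (u (fst q))" and snd_q: "\<forall>K\<in>T. snd q K = Xi (\<rho> K) (fst q K)"
        by (simp_all add: step_iff)
      \<comment> \<open>The comparison of solutions holds in both directions; multiplying by the
        Gibbs weight returns from \<open>u\<close> to \<open>\<theta>\<close>.\<close>
      have eq: "fst q K = \<theta> K" if "K \<in> T" for K
        using solution_le[OF sol \<open>solution (u \<theta>)\<close> that] solution_le[OF \<open>solution (u \<theta>)\<close> sol that]
        by (metis antisym p_u)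
      have "fst q = \<theta>"
        using q eq by (intro PiE_ext[of _ T "\<lambda>_. UNIV"]) (auto simp: \<theta>_def)
      moreover have "snd q = \<rho>'"
        using q eq snd_q by (intro PiE_ext[of _ T "\<lambda>_. UNIV"]) (auto simp: \<rho>'_def)
      ultimately show "q = (\<theta>, \<rho>')" by (simp add: prod_eq_iff)
    qed
  next
    fix \<theta> \<rho>' assume "scheme_step T E EK x V \<tau> \<rho> \<theta> \<rho>'"
    then have sol: "solution (u \<theta>)" and \<rho>': "\<And>K. K \<in> T \<Longrightarrow> \<rho>' K = Xi (\<rho> K) (\<theta> K)"
      by (simp_all add: step_iff)
    show pos: "0 < \<theta> K" if "K \<in> T" for K
      using solution_pos[OF sol that] by (simp add: u_def gibbs_def zero_less_divide_iff)
    show "0 \<le> \<rho>' K" if "K \<in> T" for K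
      using Xi_nonneg pos[OF that] \<rho>'[OF that] by simp
    show "(\<Sum>K\<in>T. measure lebesgue K * \<rho>' K) = (\<Sum>K\<in>T. measure lebesgue K * \<rho> K)"
      using solution_mass[OF sol] \<rho>' by (simp add: p_u)
    show "\<theta> K \<le> (\<rho>' K + \<rho> K) / 2" "min (\<rho>' K) (\<rho> K) \<le> \<theta> K" if "K \<in> T" for K
      using Xi_between[OF rho_nonneg[OF that] pos[OF that]] \<rho>'[OF that] by simp_all
  qed
qed

end
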